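(* Let $a,b,c\in\mathbb{Q}$ with $abc\neq 0$, $ac-b^2\neq0$, $3ac-b^2\neq0$ and $4ac-b^2\neq0$, and let \[\mathcal{E}_4:\ Y^2=X^3-3a^6c^2X-a^6(2ac-b^2)(a^2c^2-4ab^2c+b^4)\] over $\mathbb{Q}$. If $b^2\neq \tfrac32 ac$, then $\mathcal{E}_4(\mathbb{Q})$ has positive rank. If $b^2=\tfrac32 ac$, then $\mathcal{E}_4(\mathbb{Q})$ has rank $0$. *)

theory Defs
  imports Complex_Main "HOL-Algebra.FiniteProduct" "HOL-Library.Extended_Nat"
begin

section \<open>Short Weierstrass curves and their groups of points\<close>

datatype 'a ec_point = Infinity | Affine 'a 'a

text \<open>The curve \<open>Y^2 = X^3 + A X + B\<close>; the type \<open>'a\<close> is the field of definition, so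
  \<open>ec_points A B\<close> is the set of points rational over \<open>'a\<close>.\<close>

definition ec_points :: "'a::field \<Rightarrow> 'a \<Rightarrow> 'a ec_point set" where
  "ec_points A B = insert Infinity {Affine x y | x y. y^2 = x^3 + A * x + B}"

definition ec_nonsingular :: "'a::field \<Rightarrow> 'a \<Rightarrow> bool" where
  "ec_nonsingular A B \<longleftrightarrow> 4 * A^3 + 27 * B^2 \<noteq> 0"

text \<open>The chord-and-tangent law, in characteristic different from 2. Two points of the
  curve with equal first coordinates that are not opposite to each other coincide, and the slope
  \<open>m\<close> is then that of the tangent.\<close>

fun ec_add :: "'a::field \<Rightarrow> 'a ec_point \<Rightarrow> 'a ec_point \<Rightarrow> 'a ec_point" where
  "ec_add A Infinity Q = Q"
| "ec_add A P Infinity = P"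
| "ec_add A (Affine x1 y1) (Affine x2 y2) =
    (if x1 = x2 \<and> y1 = - y2 then Infinity
     else let m = (if x1 = x2 then (3 * x1^2 + A) / (2 * y1) else (y2 - y1) / (x2 - x1));
              x3 = m^2 - x1 - x2
          in Affine x3 (m * (x1 - x3) - y1))"

text \<open>The group is written multiplicatively, as everywhere in HOL-Algebra: the multiple
  \<open>n P\<close> is \<open>P [^] n\<close>.\<close>

definition ec_group :: "'a::field \<Rightarrow> 'a \<Rightarrow> 'a ec_point monoid" where
  "ec_group A B = \<lparr>carrier = ec_points A B, mult = ec_add A, one = Infinity\<rparr>"

lemma ec_add_closed:
  fixes A B :: "'a::field_char_0"
  assumes "P \<in> ec_points A B" "Q \<in> ec_points A B"
  shows "ec_add A P Q \<in> ec_points A B"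
proof (cases P)
  case Infinity
  then show ?thesis using assms by simp
next
  case P: (Affine x1 y1)
  show ?thesis
  proof (cases Q)
    case Infinity
    then show ?thesis using assms P by simp
  next
    case Q: (Affine x2 y2)
    have e1: "y1^2 = x1^3 + A * x1 + B" and e2: "y2^2 = x2^3 + A * x2 + B"
      using assms P Q by (auto simp: ec_points_def)
    show ?thesis
    proof (cases "x1 = x2")
      case True
      show ?thesis
      proof (cases "y1 = - y2")
        case True
        then show ?thesis using \<open>x1 = x2\<close> P Q by (simp add: ec_points_def)
      next
        case False
        have "(y1 - y2) * (y1 + y2) = 0"
          using e1 e2 \<open>x1 = x2\<close> by (simp add: algebra_simps power2_eq_square)
        then have yy: "y1 = y2" using False by (auto simp: eq_neg_iff_add_eq_0)
        then have y0: "y1 \<noteq> 0" using False by auto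
        define m where "m = (3 * x1^2 + A) / (2 * y1)"
        have m: "2 * y1 * m = 3 * x1^2 + A" using y0 by (simp add: m_def)
        have "(m * (x1 - (m^2 - x1 - x1)) - y1)^2
            = (m^2 - x1 - x1)^3 + A * (m^2 - x1 - x1) + B"
          using m e1 by algebra
        then show ?thesis
          using P Q \<open>x1 = x2\<close> yy False by (simp add: ec_points_def Let_def m_def)
      qed
    next
      case False
      define m where "m = (y2 - y1) / (x2 - x1)"
      have m: "m * (x2 - x1) = y2 - y1" using False by (simp add: m_def)
      have "(x2 - x1) * ((m * (x1 - (m^2 - x1 - x2)) - y1)^2
          - ((m^2 - x1 - x2)^3 + A * (m^2 - x1 - x2) + B)) = 0"
        using m e1 e2 by algebra
      then have "(m * (x1 - (m^2 - x1 - x2)) - y1)^2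
          = (m^2 - x1 - x2)^3 + A * (m^2 - x1 - x2) + B"
        using False by simp
      then show ?thesis
        using P Q False by (simp add: ec_points_def Let_def m_def)
    qed
  qed
qed

section \<open>The rank of an abelian group\<close>

text \<open>The rank is the maximal number of elements that are linearly independent over the
  integers, i.e. the dimension of the tensor product with the rationals; for a finitely generated
  group it is the exponent \<open>r\<close> in the decomposition as \<open>\<int>^r\<close> times a finite group. The value
  \<open>\<infinity>\<close> occurs when there are independent sets of every finite size.\<close>

definition int_independent :: "('a, 'm) monoid_scheme \<Rightarrow> 'a set \<Rightarrow> bool" where
  "int_independent G S \<longleftrightarrow> finite S \<and> S \<subseteq> carrier G \<and>
    (\<forall>n :: 'a \<Rightarrow> int. (\<Otimes>\<^bsub>G\<^esub>P\<in>S. P [^]\<^bsub>G\<^esub> n P) = \<one>\<^bsub>G\<^esub> \<longrightarrow> (\<forall>P\<in>S. n P = 0))"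

definition abelian_rank :: "('a, 'm) monoid_scheme \<Rightarrow> enat" where
  "abelian_rank G = (SUP S\<in>{S. int_independent G S}. enat (card S))"

section \<open>The curve \<open>E\<^sub>4\<close>\<close>

definition E4_A :: "rat \<Rightarrow> rat \<Rightarrow> rat \<Rightarrow> rat" where
  "E4_A a b c = - 3 * a^6 * c^2"

definition E4_B :: "rat \<Rightarrow> rat \<Rightarrow> rat \<Rightarrow> rat" where
  "E4_B a b c = - (a^6 * (2 * a * c - b^2) * (a^2 * c^2 - 4 * a * b^2 * c + b^4))"

definition E4_group :: "rat \<Rightarrow> rat \<Rightarrow> rat \<Rightarrow> rat ec_point monoid" where
  "E4_group a b c = ec_group (E4_A a b c) (E4_B a b c)"

lemma E4_nonsingular:
  assumes "a * b * c \<noteq> 0" "a * c - b^2 \<noteq> 0" "3 * a * c - b^2 \<noteq> 0" "4 * a * c - b^2 \<noteq> 0"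
  shows "ec_nonsingular (E4_A a b c) (E4_B a b c)"
proof -
  have "4 * (E4_A a b c)^3 + 27 * (E4_B a b c)^2
      = - 27 * a^12 * b^2 * (3 * a * c - b^2)^2 * (a * c - b^2)^2 * (4 * a * c - b^2)"
    unfolding E4_A_def E4_B_def by algebra
  then show ?thesis using assms by (simp add: ec_nonsingular_def)
qed

end

theory Submission
  imports Defs "HOL-Computational_Algebra.Nth_Powers"
begin

text \<open>The point \<open>P = (- a^3 c, a^3 b (3ac - b^2))\<close> lies on the curve and its tangent is horizontal.
  Up to scaling everything depends on \<open>ac/b^2 = r/s\<close> only. One of \<open>3P\<close>, \<open>4P\<close>, \<open>6P\<close> (depending on
  \<open>r\<close> modulo 4) has a first coordinate that is not integral at 2, unless it is the point at
  infinity, which happens for \<open>r/s = 2/3\<close> only. Doubling a point that is not integral at 2 lowers the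
  2-adic valuation of the first coordinate by exactly 2, so the iterated doubles are pairwise
  distinct and \<open>P\<close> has infinite order. Of the group law this uses just \<open>2(nP) = (2n)P\<close>, which follows
  from \<open>2(Q + P) = (2Q + P) + P\<close>.

  For \<open>r/s = 2/3\<close> the curve is isomorphic to \<open>y^2 = u^3 + u^2 - u\<close>, of conductor 20. Fermat descent on
  \<open>x^4 + x^2 y^2 - y^4 = z^2\<close> shows that it has six rational points, all killed by 6.\<close>

section \<open>The chord-and-tangent law\<close>

fun ec_neg :: "'a::field ec_point \<Rightarrow> 'a ec_point" where
  "ec_neg Infinity = Infinity"
| "ec_neg (Affine x y) = Affine x (- y)"

lemma ec_neg_neg [simp]: "ec_neg (ec_neg P) = P"
  by (cases P) auto

lemma ec_neg_closed: "P \<in> ec_points A B \<Longrightarrow> ec_neg P \<in> ec_points A B"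
  by (cases P) (auto simp: ec_points_def)

lemma ec_add_Infinity_right [simp]: "ec_add A P Infinity = P"
  by (cases P) auto

lemma ec_add_neg_right [simp]: "ec_add A P (ec_neg P) = Infinity"
  by (cases P) auto

lemma ec_add_chord:
  assumes "x1 \<noteq> x2" "m * (x2 - x1) = y2 - y1"
  shows "ec_add A (Affine x1 y1) (Affine x2 y2) =
    Affine (m^2 - x1 - x2) (m * (x1 - (m^2 - x1 - x2)) - y1)"
proof -
  have "(y2 - y1) / (x2 - x1) = m" using assms by (simp add: field_simps)
  then show ?thesis using assms(1) by (simp add: Let_def)
qed

lemma ec_add_neg_left [simp]: "ec_add A (ec_neg P) P = Infinity"
  by (cases P) auto

text \<open>Reflection in the x-axis negates the slope of every chord and tangent.\<close>

lemma ec_neg_add: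
  "ec_neg (ec_add A P Q) = ec_add A (ec_neg P) (ec_neg Q)"
  for A :: "'a::field"
proof (cases "P = Infinity \<or> Q = Infinity")
  case False
  then obtain x1 y1 x2 y2 where P: "P = Affine x1 y1" and Q: "Q = Affine x2 y2"
    by (metis ec_point.exhaust)
  show ?thesis
  proof (cases "x1 = x2")
    case True
    have "(3 * x2^2 + A) / (2 * - y1) = - ((3 * x2^2 + A) / (2 * y1))"
      by (simp only: mult_minus_right divide_minus_right)
    moreover have "- y1 = y2 \<longleftrightarrow> y1 = - y2" by auto
    ultimately show ?thesis using True by (auto simp: P Q Let_def algebra_simps)
  next
    case False
    define m where "m = (y2 - y1) / (x2 - x1)"
    have m: "m * (x2 - x1) = y2 - y1" using False by (simp add: m_def)
    then have m': "- m * (x2 - x1) = - y2 - - y1" by simp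
    show ?thesis unfolding P Q ec_neg.simps ec_add_chord[OF False m] ec_add_chord[OF False m']
      by (simp add: algebra_simps)
  qed
qed auto

lemma ec_add_tangent:
  fixes A :: "'a::field_char_0"
  assumes "y \<noteq> 0" "2 * y * m = 3 * x^2 + A"
  shows "ec_add A (Affine x y) (Affine x y) =
    Affine (m^2 - x - x) (m * (x - (m^2 - x - x)) - y)"
proof -
  have "(3 * x^2 + A) / (2 * y) = m" using assms by (simp add: field_simps)
  then show ?thesis using assms(1) by (simp add: Let_def)
qed

lemma ec_point_eq_or_neg:
  assumes "Affine x y1 \<in> ec_points A B" "Affine x y2 \<in> ec_points A B"
  shows "y1 = y2 \<or> y1 = - (y2 :: 'a::field)"
  using assms by (simp add: ec_points_def) (metis power2_eq_iff)

lemma ec_add_commute: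
  fixes A B :: "'a::field_char_0"
  assumes "P \<in> ec_points A B" "Q \<in> ec_points A B"
  shows "ec_add A P Q = ec_add A Q P"
proof (cases "P = Infinity \<or> Q = Infinity")
  case False
  then obtain x1 y1 x2 y2 where P: "P = Affine x1 y1" and Q: "Q = Affine x2 y2"
    by (metis ec_point.exhaust)
  show ?thesis
  proof (cases "x1 = x2")
    case True
    then show ?thesis using ec_point_eq_or_neg[of x1 y1 A B y2] assms P Q by auto
  next
    case False
    define m where "m = (y2 - y1) / (x2 - x1)"
    have m: "m * (x2 - x1) = y2 - y1" using False by (simp add: m_def)
    then have m': "m * (x1 - x2) = y1 - y2" by algebra
    show ?thesis unfolding P Q ec_add_chord[OF False m] ec_add_chord[OF False[symmetric] m']
      using m by (simp add: algebra_simps)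
  qed
qed auto

text \<open>The points \<open>P\<close>, \<open>Q\<close> and \<open>- (P + Q)\<close> lie on one
  line of slope \<open>m\<close>. Its mirror image, of slope \<open>- m\<close>, passes through
  \<open>P + Q\<close> and \<open>- Q\<close> and meets the curve again at \<open>- P\<close>.
  Nonsingularity enters when \<open>P + Q = - Q\<close>, where the slope has to come from the
  tangent.\<close>

lemma ec_add_cancel:
  fixes A B :: "'a::field_char_0"
  assumes ns: "ec_nonsingular A B" and P: "P \<in> ec_points A B" and Q: "Q \<in> ec_points A B"
  shows "ec_add A (ec_add A P Q) (ec_neg Q) = P"
proof (cases "P = Infinity \<or> Q = Infinity \<or> P = ec_neg Q")
  case False
  then obtain x1 y1 x2 y2 where PQ: "P = Affine x1 y1" "Q = Affine x2 y2"
    by (metis ec_point.exhaust)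
  have e1: "y1^2 = x1^3 + A * x1 + B" and e2: "y2^2 = x2^3 + A * x2 + B"
    using P Q PQ by (auto simp: ec_points_def)
  \<comment> \<open>One description for chord and tangent: \<open>m\<close> is the slope of the line
    through \<open>P\<close> and \<open>Q\<close>, and the tangent condition is recorded for the
    case of equal first coordinates.\<close>
  have "\<exists>m. y1 + m * (x2 - x1) = y2 \<and> (x1 = x2 \<longrightarrow> 2 * y1 * m = 3 * x1^2 + A \<and> y2 \<noteq> 0) \<and>
      ec_add A P Q = Affine (m^2 - x1 - x2) (m * (x1 - (m^2 - x1 - x2)) - y1)"
  proof (cases "x1 = x2")
    case True
    then have "y1 = y2" using ec_point_eq_or_neg[of x1 y1 A B y2] P Q PQ False by auto
    moreover have "y1 \<noteq> 0" using False PQ True \<open>y1 = y2\<close> by auto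
    ultimately show ?thesis using ec_add_tangent[of y1 "(3 * x1^2 + A) / (2 * y1)" x1 A] True PQ
      by (intro exI[of _ "(3 * x1^2 + A) / (2 * y1)"]) auto
  next
    case False
    then show ?thesis using ec_add_chord[of x1 x2 "(y2 - y1) / (x2 - x1)" y2 y1 A] PQ
      by (intro exI[of _ "(y2 - y1) / (x2 - x1)"]) auto
  qed
  then obtain m x3 y3 where m: "y1 + m * (x2 - x1) = y2"
    and t: "x1 = x2 \<Longrightarrow> 2 * y1 * m = 3 * x1^2 + A \<and> y2 \<noteq> 0"
    and R: "ec_add A P Q = Affine x3 y3"
    and x3: "x3 = m^2 - x1 - x2" and y3: "y3 = m * (x1 - x3) - y1"
    by blast
  show ?thesis
  proof (cases "x3 = x2")
    case False
    have "- m * (x2 - x3) = - y2 - y3"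
      unfolding y3 m[symmetric] by (simp add: algebra_simps)
    moreover have "(- m)^2 - x3 - x2 = x1" using x3 by simp
    moreover have "- m * (x3 - x1) - y3 = y1" using y3 by algebra
    ultimately have "ec_add A (Affine x3 y3) (Affine x2 (- y2)) = Affine x1 y1"
      by (metis ec_add_chord[OF False])
    then show ?thesis unfolding R unfolding PQ ec_neg.simps .
  next
    case True
    \<comment> \<open>Here \<open>P + Q = - Q\<close>, so the line through \<open>P\<close> and
      \<open>Q\<close> touches the curve at \<open>Q\<close>. If \<open>y2\<close> were 0, the
      finite slope \<open>m\<close> would make \<open>Q\<close> a singular point.\<close>
    have y32: "y3 = - y2"
      unfolding y3 m[symmetric] True by (simp add: algebra_simps)
    have tang: "2 * y2 * m = 3 * x2^2 + A"
    proof (cases "x1 = x2")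
      case True
      then show ?thesis using t m by simp
    next
      case False
      have "(x2 - x1) * (2 * y2 * m - (3 * x2^2 + A)) = 0"
      proof -
        have "m * (x2 - x1) = y2 - y1" using m by (simp add: algebra_simps)
        moreover have "m^2 = x1 + 2 * x2" using x3 True by (simp add: algebra_simps)
        ultimately show ?thesis using e1 e2 by algebra
      qed
      then show ?thesis using False by simp
    qed
    have "y2 \<noteq> 0"
    proof
      assume "y2 = 0"
      then have "4 * A^3 + 27 * B^2 = 0" using tang e2 by algebra
      then show False using ns by (simp add: ec_nonsingular_def)
    qed
    then have "ec_add A (Affine x2 (- y2)) (Affine x2 (- y2)) =
        Affine ((- m)^2 - x2 - x2) (- m * (x2 - ((- m)^2 - x2 - x2)) - - y2)"
      using tang by (intro ec_add_tangent) auto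
    moreover have "(- m)^2 - x2 - x2 = x1" using x3 True by (simp add: algebra_simps)
    moreover have "- m * (x2 - x1) - - y2 = y1"
      unfolding m[symmetric] by (simp add: algebra_simps)
    ultimately have "ec_add A (Affine x2 (- y2)) (Affine x2 (- y2)) = Affine x1 y1"
      by (simp only:)
    then show ?thesis unfolding R unfolding PQ ec_neg.simps True y32 .
  qed
qed auto

text \<open>The instance of associativity from which \<open>ec_double_add\<close> is derived.
  Degenerate positions follow from commutativity, cancellation and negation; in the generic one
  every slope is expressed through \<open>m\<close>, \<open>l\<close> and one auxiliary quantity
  \<open>v\<close>.\<close>

lemma ec_add_double_assoc:
  fixes A B :: "'a::field_char_0"
  assumes ns: "ec_nonsingular A B" and Q: "Q \<in> ec_points A B" and P: "P \<in> ec_points A B"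
  shows "ec_add A (ec_add A Q Q) P = ec_add A Q (ec_add A Q P)"
proof -
  note cl = ec_add_closed ec_neg_closed
  note cm = ec_add_commute[of _ A B]
  consider "Q = Infinity \<or> P = Infinity" | "P = Q" | "P = ec_neg Q" | "Q = ec_neg Q"
    | "ec_add A Q P = ec_neg Q"
    | "Q \<noteq> Infinity" "P \<noteq> Infinity" "P \<noteq> Q" "P \<noteq> ec_neg Q" "Q \<noteq> ec_neg Q" "ec_add A Q P \<noteq> ec_neg Q"
    by blast
  then show ?thesis
  proof cases
    case 1
    then show ?thesis by auto
  next
    case 2
    then show ?thesis using cm cl Q by metis
  next
    case 3
    then show ?thesis using ec_add_cancel[OF ns Q Q] by simp
  next
    case 4
    then have "ec_add A Q Q = Infinity" by (metis ec_add_neg_right)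
    moreover have "ec_add A Q (ec_add A Q P) = P"
      using ec_add_cancel[OF ns P Q] 4 cm cl Q P by metis
    ultimately show ?thesis by simp
  next
    case 5
    have "P = ec_add A (ec_neg Q) (ec_neg Q)"
      using ec_add_cancel[OF ns P Q] 5 cm Q P by metis
    then show ?thesis using 5 by (metis ec_neg_add ec_add_neg_right)
  next
    case 6
    then obtain x1 y1 x2 y2 where PQ: "Q = Affine x1 y1" "P = Affine x2 y2"
      by (metis ec_point.exhaust)
    have e1: "y1^2 = x1^3 + A * x1 + B" and e2: "y2^2 = x2^3 + A * x2 + B"
      using P Q PQ by (auto simp: ec_points_def)
    have x12: "x1 \<noteq> x2" using ec_point_eq_or_neg[of x1 y1 A B y2] P Q PQ 6 by auto
    have y1: "y1 \<noteq> 0" using 6 PQ by auto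
    define m where "m = (y2 - y1) / (x2 - x1)"
    have m: "m * (x2 - x1) = y2 - y1" using x12 by (simp add: m_def)
    define l where "l = (3 * x1^2 + A) / (2 * y1)"
    have l: "2 * y1 * l = 3 * x1^2 + A" using y1 by (simp add: l_def)
    define x3 y3 where "x3 = m^2 - x1 - x2" and "y3 = m * (x1 - x3) - y1"
    have QP: "ec_add A Q P = Affine x3 y3"
      unfolding PQ ec_add_chord[OF x12 m] x3_def y3_def ..
    define x5 y5 where "x5 = l^2 - x1 - x1" and "y5 = l * (x1 - x5) - y1"
    have QQ: "ec_add A Q Q = Affine x5 y5"
      unfolding PQ ec_add_tangent[OF y1 l] x5_def y5_def ..
    have x31: "x3 \<noteq> x1"
    proof
      assume "x3 = x1"
      then have "ec_add A Q P = ec_neg Q" using QP PQ y3_def by simp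
      then show False using 6 by simp
    qed
    \<comment> \<open>Put \<open>t = x - x1\<close>. On the chord through \<open>Q\<close> and
      \<open>P\<close> the curve equation divided by \<open>t\<close> is a quadratic with roots
      \<open>x2 - x1\<close> and \<open>x3 - x1\<close> and constant term
      \<open>3 * x1^2 + A - 2 * y1 * m = 2 * y1 * (l - m)\<close>.\<close>
    have "(x2 - x1) * ((x2 - x1) * (x3 - x1) - 2 * y1 * (l - m)) = 0"
      using m l e1 e2 x3_def by algebra
    then have dd: "(x2 - x1) * (x3 - x1) = 2 * y1 * (l - m)" using x12 by simp
    then have lm: "l - m \<noteq> 0" using x12 x31 by auto
    \<comment> \<open>The second chord on the right has slope \<open>- m - v\<close>
      and the chord on the left has slope \<open>- l - v\<close>.\<close>
    define v where "v = (x2 - x1) / (l - m)"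
    have v: "v * (l - m) = x2 - x1" using lm by (simp add: v_def)
    have "(l - m) * (v * (x3 - x1) - 2 * y1) = 0" using v dd by algebra
    then have v': "v * (x3 - x1) = 2 * y1" using lm by simp
    have n: "(- m - v) * (x3 - x1) = y3 - y1" using v' y3_def by algebra
    have L: "ec_add A Q (ec_add A Q P) =
        Affine ((- m - v)^2 - x1 - x3) ((- m - v) * (x1 - ((- m - v)^2 - x1 - x3)) - y1)"
      unfolding QP unfolding PQ ec_add_chord[OF x31[symmetric] n] ..
    have k: "(- l - v) * (x2 - x5) = y2 - y5" using v v' m y5_def x5_def x3_def by algebra
    have R: "ec_add A (ec_add A Q Q) P =
        Affine ((- l - v)^2 - x5 - x2) ((- l - v) * (x5 - ((- l - v)^2 - x5 - x2)) - y5)"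
    proof (cases "x5 = x2")
      case False
      show ?thesis unfolding QQ unfolding PQ ec_add_chord[OF False k] ..
    next
      case True
      \<comment> \<open>Now \<open>2Q = P\<close>, so the left side doubles \<open>P\<close> and its
        slope is that of the tangent at \<open>P\<close>. If \<open>y2 = 0\<close>, then
        \<open>2Q = P = - P\<close> gives \<open>Q + P = - Q\<close>, which this case
        excludes.\<close>
      have y5: "y5 = y2" using k True by simp
      have "y2 \<noteq> 0"
      proof
        assume "y2 = 0"
        then have "ec_add A Q Q = ec_neg P" using QQ PQ True y5 by simp
        then have "ec_neg (ec_add A Q P) = Q" using ec_add_cancel[OF ns Q Q]
          by (metis ec_neg_add cm cl P Q)
        then show False using 6 by (metis ec_neg_neg)
      qed
      moreover have "2 * y2 * (- l - v) = 3 * x2^2 + A"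
        using v m l x5_def y5_def True y5 by algebra
      ultimately show ?thesis unfolding QQ unfolding PQ True y5
        by (intro ec_add_tangent) auto
    qed
    have X: "(- l - v)^2 - x5 - x2 = (- m - v)^2 - x1 - x3"
      using v x5_def x3_def by algebra
    have "(- l - v) * (x5 - z) - y5 = (- m - v) * (x1 - z) - y1"
      if "z = (- m - v)^2 - x1 - x3" for z
      using that v v' x3_def x5_def y5_def by algebra
    then show ?thesis unfolding R L X by simp
  qed
qed

lemma ec_double_add:
  fixes A B :: "'a::field_char_0"
  assumes ns: "ec_nonsingular A B" and Q: "Q \<in> ec_points A B" and P: "P \<in> ec_points A B"
  shows "ec_add A (ec_add A Q P) (ec_add A Q P) = ec_add A (ec_add A (ec_add A Q Q) P) P"
proof -
  \<comment> \<open>Apply \<open>ec_add_double_assoc\<close> twice: with \<open>S = Q + P\<close>, both \<open>2S - P\<close> and \<open>2Q + P\<close> equal \<open>S + Q\<close>.\<close>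
  note cl = ec_add_closed ec_neg_closed
  note cm = ec_add_commute[of _ A B]
  define S where "S = ec_add A Q P"
  have S: "S \<in> ec_points A B" using P Q cl S_def by metis
  have SP: "ec_add A S (ec_neg P) = Q" using ec_add_cancel[OF ns Q P] S_def by simp
  have "ec_add A (ec_add A S S) (ec_neg P) = ec_add A S Q"
    using ec_add_double_assoc[OF ns S ec_neg_closed[OF P]] SP by simp
  also have "\<dots> = ec_add A (ec_add A Q Q) P"
    using ec_add_double_assoc[OF ns Q P] cm[OF S Q] S_def by simp
  finally have "ec_add A (ec_add A (ec_add A S S) (ec_neg P)) P = ec_add A (ec_add A (ec_add A Q Q) P) P"
    by simp
  moreover have "ec_add A (ec_add A (ec_add A S S) (ec_neg P)) (ec_neg (ec_neg P)) = ec_add A S S"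
    by (rule ec_add_cancel[OF ns]) (use S P cl in auto)
  ultimately show ?thesis by (simp add: S_def)
qed

section \<open>Multiples of a point and the rank\<close>

lemma ec_group_simps [simp]:
  "carrier (ec_group A B) = ec_points A B"
  "x \<otimes>\<^bsub>ec_group A B\<^esub> y = ec_add A x y"
  "\<one>\<^bsub>ec_group A B\<^esub> = Infinity"
  by (simp_all add: ec_group_def)

lemma ec_pow_closed:
  fixes A B :: "'a::field_char_0"
  assumes "P \<in> ec_points A B"
  shows "P [^]\<^bsub>ec_group A B\<^esub> (n::nat) \<in> ec_points A B"
proof (induction n)
  case 0
  show ?case by (simp add: ec_points_def)
qed (use assms ec_add_closed in auto)

lemma ec_pow_double:
  fixes A B :: "'a::field_char_0"
  assumes "ec_nonsingular A B" "P \<in> ec_points A B"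
  shows "P [^]\<^bsub>ec_group A B\<^esub> (2 * n) =
    ec_add A (P [^]\<^bsub>ec_group A B\<^esub> n) (P [^]\<^bsub>ec_group A B\<^esub> (n::nat))"
proof (induction n)
  case (Suc n)
  then show ?case
    using ec_double_add[OF assms(1) ec_pow_closed[OF assms(2)] assms(2), of n] by simp
qed simp

text \<open>Negative powers are defined through \<open>inv\<close>, a definite description.
  Cancellation shows that \<open>ec_neg P\<close> is the only candidate.\<close>

lemma ec_m_inv:
  fixes A B :: "'a::field_char_0"
  assumes ns: "ec_nonsingular A B" and P: "P \<in> ec_points A B"
  shows "inv\<^bsub>ec_group A B\<^esub> P = ec_neg P"
  unfolding m_inv_def
proof (rule the_equality)
  fix Q assume "Q \<in> carrier (ec_group A B) \<and> P \<otimes>\<^bsub>ec_group A B\<^esub> Q = \<one>\<^bsub>ec_group A B\<^esub> \<and>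
    Q \<otimes>\<^bsub>ec_group A B\<^esub> P = \<one>\<^bsub>ec_group A B\<^esub>"
  then show "Q = ec_neg P" using ec_add_cancel[OF ns, of Q P] P by simp
qed (use P ec_neg_closed in auto)

text \<open>The library lemmas on \<open>finprod\<close> live in \<open>comm_monoid\<close>, hence need associativity. The
  products below are evaluated from the definition, so the associative law is never needed.\<close>

lemma finprod_singleton_closed:
  assumes "f a \<otimes>\<^bsub>G\<^esub> \<one>\<^bsub>G\<^esub> \<in> carrier G" "\<one>\<^bsub>G\<^esub> \<in> carrier G"
  shows "finprod G f {a} = f a \<otimes>\<^bsub>G\<^esub> \<one>\<^bsub>G\<^esub>"
proof -
  have "({a}, z) \<in> foldSetD (carrier G) (\<lambda>x. monoid.mult G (f x)) \<one>\<^bsub>G\<^esub> \<longleftrightarrow> z = f a \<otimes>\<^bsub>G\<^esub> \<one>\<^bsub>G\<^esub>" for z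
  proof
    assume "({a}, z) \<in> foldSetD (carrier G) (\<lambda>x. monoid.mult G (f x)) \<one>\<^bsub>G\<^esub>"
    from foldSetD_backwards[OF _ this] show "z = f a \<otimes>\<^bsub>G\<^esub> \<one>\<^bsub>G\<^esub>"
      by (auto elim: foldSetD.cases)
  next
    assume "z = f a \<otimes>\<^bsub>G\<^esub> \<one>\<^bsub>G\<^esub>"
    then show "({a}, z) \<in> foldSetD (carrier G) (\<lambda>x. monoid.mult G (f x)) \<one>\<^bsub>G\<^esub>"
      using assms foldSetD.insertI[OF _ _ foldSetD.emptyI, of a "\<lambda>x. monoid.mult G (f x)"] by auto
  qed
  then show ?thesis by (simp add: finprod_def foldD_def comp_def)
qed

lemma finprod_all_one:
  assumes "finite S" "\<And>x. x \<in> S \<Longrightarrow> f x = \<one>\<^bsub>G\<^esub>" "\<one>\<^bsub>G\<^esub> \<in> carrier G" "\<one>\<^bsub>G\<^esub> \<otimes>\<^bsub>G\<^esub> \<one>\<^bsub>G\<^esub> = \<one>\<^bsub>G\<^esub>"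
  shows "finprod G f S = \<one>\<^bsub>G\<^esub>"
proof -
  have uniq: "z = \<one>\<^bsub>G\<^esub>" if "(T, z) \<in> foldSetD (carrier G) (\<lambda>x. monoid.mult G (f x)) \<one>\<^bsub>G\<^esub>" "T \<subseteq> S" for T z
    using that by induction (use assms in auto)
  have "(S, \<one>\<^bsub>G\<^esub>) \<in> foldSetD (carrier G) (\<lambda>x. monoid.mult G (f x)) \<one>\<^bsub>G\<^esub>"
    using assms(1,2)
  proof (induction S)
    case (insert x S)
    then show ?case
      using foldSetD.insertI[of x S "\<lambda>x. monoid.mult G (f x)" "\<one>\<^bsub>G\<^esub>" "carrier G" "\<one>\<^bsub>G\<^esub>"] assms(3,4)
      by auto
  qed (use assms foldSetD.emptyI in auto)
  then have "(THE z. (S, z) \<in> foldSetD (carrier G) (\<lambda>x. monoid.mult G (f x)) \<one>\<^bsub>G\<^esub>) = \<one>\<^bsub>G\<^esub>"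
    using uniq by blast
  then show ?thesis using assms(1) by (simp add: finprod_def foldD_def comp_def)
qed

section \<open>Criteria for positive rank and for rank zero\<close>

lemma abelian_rank_ec_pos:
  fixes A B :: "'a::field_char_0"
  assumes ns: "ec_nonsingular A B" and P: "P \<in> ec_points A B"
    and inf: "\<And>n::nat. n > 0 \<Longrightarrow> P [^]\<^bsub>ec_group A B\<^esub> n \<noteq> Infinity"
  shows "abelian_rank (ec_group A B) > 0"
proof -
  let ?G = "ec_group A B"
  \<comment> \<open>Splitting by the sign of the exponent reduces the independence of
    \<open>{P}\<close> to the nontriviality of all positive powers.\<close>
  have pow: "P [^]\<^bsub>?G\<^esub> n = (if n < 0 then ec_neg (P [^]\<^bsub>?G\<^esub> nat (- n)) else P [^]\<^bsub>?G\<^esub> nat n)"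
    for n :: int
    unfolding int_pow_def2 ec_m_inv[OF ns ec_pow_closed[OF P]] ..
  have nz: "n = 0" if "P [^]\<^bsub>?G\<^esub> (n::int) = Infinity" for n
  proof (rule ccontr)
    assume "n \<noteq> 0"
    show False
    proof (cases "n < 0")
      case True
      then have "ec_neg (P [^]\<^bsub>?G\<^esub> nat (- n)) = Infinity"
        using that pow[of n] by simp
      then have "P [^]\<^bsub>?G\<^esub> nat (- n) = Infinity" by (metis ec_neg.simps(1) ec_neg_neg)
      then show False using inf[of "nat (- n)"] True by simp
    next
      case False
      then show False using inf[of "nat n"] that pow[of n] \<open>n \<noteq> 0\<close> by simp
    qed
  qed
  have cl: "P [^]\<^bsub>?G\<^esub> (n::int) \<in> ec_points A B" for n
    unfolding pow by (simp del: pow_nat add: ec_neg_closed ec_pow_closed[OF P])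
  have "int_independent ?G {P}"
    unfolding int_independent_def
  proof (intro conjI allI impI)
    fix n :: "'a ec_point \<Rightarrow> int"
    assume "(\<Otimes>\<^bsub>?G\<^esub>Q\<in>{P}. Q [^]\<^bsub>?G\<^esub> n Q) = \<one>\<^bsub>?G\<^esub>"
    then have "P [^]\<^bsub>?G\<^esub> n P = Infinity"
      using cl[of "n P"] by (subst (asm) finprod_singleton_closed) (auto simp: ec_points_def)
    then show "\<forall>P\<in>{P}. n P = 0" using nz by simp
  qed (use P in auto)
  then have "enat (card {P}) \<le> abelian_rank ?G"
    unfolding abelian_rank_def by (intro SUP_upper) simp
  moreover have "(0::enat) < enat (card {P})" by (simp add: zero_enat_def)
  ultimately show ?thesis by (rule less_le_trans[rotated])
qed

text \<open>Giving every point of \<open>S\<close> the exponent \<open>k\<close> yields a trivial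
  product with nonzero exponents, so only the empty set is independent.\<close>

lemma abelian_rank_ec_eq_0:
  fixes A B :: "'a::field_char_0"
  assumes "k > 0" "\<And>P. P \<in> ec_points A B \<Longrightarrow> P [^]\<^bsub>ec_group A B\<^esub> (k::nat) = Infinity"
  shows "abelian_rank (ec_group A B) = 0"
proof -
  let ?G = "ec_group A B"
  have "card S = 0" if S: "int_independent ?G S" for S
  proof (rule ccontr)
    assume "card S \<noteq> 0"
    then have "S \<noteq> {}" by auto
    have "(\<Otimes>\<^bsub>?G\<^esub>Q\<in>S. Q [^]\<^bsub>?G\<^esub> int k) = \<one>\<^bsub>?G\<^esub>"
      using S assms(2) by (intro finprod_all_one)
        (auto simp: int_independent_def int_pow_int ec_points_def)
    then show False using S \<open>S \<noteq> {}\<close> assms(1) by (auto simp: int_independent_def)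
  qed
  then show ?thesis
    unfolding abelian_rank_def by (auto simp: enat_0 intro!: SUP_eqI)
qed

section \<open>Doubling and integrality at 2\<close>

text \<open>The local ring of the rationals at the prime 2.\<close>

definition integral_2 :: "rat \<Rightarrow> bool" where
  "integral_2 x \<longleftrightarrow> (\<exists>m n. odd n \<and> x = of_int m / of_int n)"

text \<open>The unit group of that local ring. Below, \<open>unit_2 (x * 2 ^ k)\<close> expresses
  that \<open>x\<close> has 2-adic valuation \<open>- k\<close>, hence a pole of order
  \<open>k\<close> if \<open>k > 0\<close>.\<close>

definition unit_2 :: "rat \<Rightarrow> bool" where
  "unit_2 x \<longleftrightarrow> (\<exists>m n. odd m \<and> odd n \<and> x = of_int m / of_int n)"

lemma of_int_odd_nonzero: "odd n \<Longrightarrow> (of_int n :: rat) \<noteq> 0"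
  by (metis even_zero of_int_eq_0_iff)

lemma integral_2_add: "integral_2 x \<Longrightarrow> integral_2 y \<Longrightarrow> integral_2 (x + y)"
  unfolding integral_2_def
proof clarify
  fix a b c d :: int assume "odd b" "odd d"
  then show "\<exists>m n. odd n \<and> of_int a / of_int b + of_int c / of_int d = (of_int m :: rat) / of_int n"
    using of_int_odd_nonzero[of b] of_int_odd_nonzero[of d]
    by (intro exI[of _ "a * d + c * b"] exI[of _ "b * d"]) (simp add: add_frac_eq)
qed

lemma integral_2_mult: "integral_2 x \<Longrightarrow> integral_2 y \<Longrightarrow> integral_2 (x * y)"
  unfolding integral_2_def
proof clarify
  fix a b c d :: int assume "odd b" "odd d"
  then show "\<exists>m n. odd n \<and> of_int a / of_int b * (of_int c / of_int d) = (of_int m :: rat) / of_int n"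
    by (intro exI[of _ "a * c"] exI[of _ "b * d"]) simp
qed

lemma integral_2_of_int [simp]: "integral_2 (of_int m)"
  unfolding integral_2_def by (intro exI[of _ m] exI[of _ 1]) simp

lemma integral_2_numeral [simp]: "integral_2 (numeral k)"
  using integral_2_of_int[of "numeral k"] by simp

lemma integral_2_1 [simp]: "integral_2 1"
  using integral_2_of_int[of 1] by simp

lemma integral_2_uminus: "integral_2 x \<Longrightarrow> integral_2 (- x)"
  using integral_2_mult[of "of_int (- 1)" x] by (simp only: integral_2_of_int) simp

lemma integral_2_diff: "integral_2 x \<Longrightarrow> integral_2 y \<Longrightarrow> integral_2 (x - y)"
  using integral_2_add[of x "- y"] integral_2_uminus by simp

lemma integral_2_power: "integral_2 x \<Longrightarrow> integral_2 (x ^ n)"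
  by (induction n) (auto intro: integral_2_mult)

lemma unit_2_imp_integral_2: "unit_2 x \<Longrightarrow> integral_2 x"
  unfolding unit_2_def integral_2_def by blast

lemmas integral_2_intros = integral_2_add integral_2_mult integral_2_diff integral_2_uminus
  integral_2_power integral_2_of_int integral_2_numeral

lemma unit_2_of_int: "odd m \<Longrightarrow> unit_2 (of_int m)"
  unfolding unit_2_def by (intro exI[of _ m] exI[of _ 1]) simp

lemma unit_2_mult: "unit_2 x \<Longrightarrow> unit_2 y \<Longrightarrow> unit_2 (x * y)"
  unfolding unit_2_def
proof clarify
  fix a b c d :: int assume "odd a" "odd b" "odd c" "odd d"
  then show "\<exists>m n. odd m \<and> odd n \<and> of_int a / of_int b * (of_int c / of_int d) = (of_int m :: rat) / of_int n"
    by (intro exI[of _ "a * c"] exI[of _ "b * d"]) simp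
qed

lemma unit_2_power: "unit_2 x \<Longrightarrow> unit_2 (x ^ n)"
  using unit_2_of_int[of 1] by (induction n) (auto intro: unit_2_mult)

lemma unit_2_divide: "unit_2 x \<Longrightarrow> unit_2 y \<Longrightarrow> unit_2 (x / y)"
  unfolding unit_2_def
proof clarify
  fix a b c d :: int assume "odd a" "odd b" "odd c" "odd d"
  then show "\<exists>m n. odd m \<and> odd n \<and> of_int a / of_int b / (of_int c / of_int d) = (of_int m :: rat) / of_int n"
    by (intro exI[of _ "a * d"] exI[of _ "b * c"]) simp
qed

lemma unit_2_add_even: "unit_2 x \<Longrightarrow> integral_2 y \<Longrightarrow> unit_2 (x + 2 * y)"
  unfolding unit_2_def integral_2_def
proof clarify
  fix a b c d :: int assume "odd a" "odd b" "odd d"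
  then show "\<exists>m n. odd m \<and> odd n \<and> of_int a / of_int b + 2 * (of_int c / of_int d) = (of_int m :: rat) / of_int n"
    using of_int_odd_nonzero[of b] of_int_odd_nonzero[of d]
    by (intro exI[of _ "a * d + 2 * c * b"] exI[of _ "b * d"]) (simp add: add_frac_eq)
qed

lemma unit_2_nonzero: "unit_2 x \<Longrightarrow> x \<noteq> 0"
  unfolding unit_2_def by (auto simp: of_int_odd_nonzero)

lemma not_unit_2_even: "integral_2 x \<Longrightarrow> \<not> unit_2 (2 * x)"
proof
  assume x: "integral_2 x" "unit_2 (2 * x)"
  from x(1) obtain m n where mn: "odd n" "x = of_int m / of_int n" by (auto simp: integral_2_def)
  from x(2) obtain p q where pq: "odd p" "odd q" "2 * x = of_int p / of_int q"
    by (auto simp: unit_2_def)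
  have "(of_int (2 * m * q) :: rat) = of_int (p * n)"
    using mn pq of_int_odd_nonzero by (simp add: frac_eq_eq)
  then have "2 * m * q = p * n" by (simp only: of_int_eq_iff)
  then show False using mn pq by (metis dvd_triv_left even_mult_iff mult.assoc)
qed

lemma unit_2_pole_unique:
  assumes "unit_2 (x * 2 ^ i)" "unit_2 (x * 2 ^ j)"
  shows "i = j"
proof -
  have "False" if "i < j" "unit_2 (x * 2 ^ i)" "unit_2 (x * 2 ^ j)" for i j
  proof -
    obtain d where j: "j = Suc (i + d)" using less_imp_Suc_add[OF \<open>i < j\<close>] by auto
    have "integral_2 (x * 2 ^ i * 2 ^ d)" using that(2) by (intro integral_2_intros unit_2_imp_integral_2)
    from not_unit_2_even[OF this] show False using that(3) by (simp add: j power_add mult_ac)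
  qed
  from this[of i j] this[of j i] show ?thesis using assms by (meson linorder_neqE_nat)
qed

text \<open>Ultrametric principle: adding a 2-integral number does not change a pole.\<close>

lemma unit_2_pole_add:
  assumes "unit_2 (x * 2 ^ k)" "k > 0" "integral_2 y"
  shows "unit_2 ((x + y) * 2 ^ k)"
proof -
  obtain j where k: "k = Suc j" using assms(2) gr0_implies_Suc by blast
  have "unit_2 (x * 2 ^ k + 2 * (y * 2 ^ j))"
    using assms(1,3) by (intro unit_2_add_even integral_2_intros)
  then show ?thesis by (simp add: k algebra_simps)
qed

text \<open>The order of the pole is one plus the valuation of \<open>y\<close>, which is
  \<open>multiplicity 2 m\<close> for \<open>y = m / n\<close> with \<open>n\<close> odd.\<close>

lemma unit_2_divide_even:
  assumes "unit_2 x" "integral_2 y" "y \<noteq> 0"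
  shows "\<exists>k>0. unit_2 (x / (2 * y) * 2 ^ k)"
proof -
  obtain m n where mn: "odd n" "y = of_int m / of_int n" using assms(2) by (auto simp: integral_2_def)
  then have "m \<noteq> 0" using assms(3) by auto
  then obtain m' where m: "m = 2 ^ multiplicity 2 m * m'" "odd m'"
    by (elim multiplicity_decompose'[of m 2]) auto
  show ?thesis
  proof (intro exI[of _ "Suc (multiplicity 2 m)"] conjI)
    have "x / (2 * y) * 2 ^ Suc (multiplicity 2 m) = x * (of_int n / of_int m')"
      using mn m(2) of_int_odd_nonzero[of m'] of_int_odd_nonzero[of n] by (subst mn, subst m) (simp add: field_simps)
    moreover have "unit_2 (of_int n / of_int m')" using mn m by (auto simp: unit_2_def)
    ultimately show "unit_2 (x / (2 * y) * 2 ^ Suc (multiplicity 2 m))"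
      using unit_2_mult[OF assms(1)] by (simp only:)
  qed simp
qed

section \<open>The duplication formula and poles at 2\<close>

lemma ec_double_affine:
  fixes A B :: "'a::field_char_0"
  assumes "Affine x y \<in> ec_points A B" "y \<noteq> 0"
  shows "\<exists>y'. ec_add A (Affine x y) (Affine x y) =
    Affine ((x^4 - 2 * A * x^2 - 8 * B * x + A^2) / (4 * y^2)) y'"
proof -
  define m where "m = (3 * x^2 + A) / (2 * y)"
  have m: "2 * y * m = 3 * x^2 + A" using assms by (simp add: m_def)
  have "y^2 = x^3 + A * x + B" using assms by (simp add: ec_points_def)
  then have "(m^2 - x - x) * (4 * y^2) = x^4 - 2 * A * x^2 - 8 * B * x + A^2" using m by algebra
  then have "m^2 - x - x = (x^4 - 2 * A * x^2 - 8 * B * x + A^2) / (4 * y^2)"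
    using assms(2) by (simp add: eq_divide_eq)
  then show ?thesis using ec_add_tangent[OF assms(2) m] by auto
qed

text \<open>At a pole the terms \<open>x^4\<close> and \<open>4 * x^3\<close> dominate the numerator
  and denominator of the duplication formula, so \<open>w * x'\<close> has the valuation of
  \<open>w * x / 4\<close>. With \<open>X = w * x\<close> the curve reads
  \<open>w^3 * y^2 = X^3 + w^2 * A * X + w^3 * B\<close>, so any \<open>w\<close> making these
  coefficients 2-integral serves, square or not.\<close>

lemma ec_double_pole_2:
  assumes P: "Affine x y \<in> ec_points A B"
    and w: "w \<noteq> 0" "integral_2 (w^2 * A)" "integral_2 (w^3 * B)"
    and u: "unit_2 (w * x * 2 ^ k)" "k > 0"
  shows "\<exists>x' y'. ec_add A (Affine x y) (Affine x y) = Affine x' y' \<and> unit_2 (w * x' * 2 ^ (k + 2))"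
proof -
  obtain j where k: "k = Suc j" using u(2) gr0_implies_Suc by blast
  define g u a b where "g = (2::rat) ^ j" and "u = w * x * 2 ^ k" and "a = w^2 * A" and "b = w^3 * B"
  have g: "integral_2 g" unfolding g_def by (intro integral_2_intros)
  have uu: "unit_2 u" "u = w * x * (2 * g)" using u by (simp_all add: u_def k g_def)
  have ab: "integral_2 a" "integral_2 b" using w by (simp_all add: a_def b_def)
  note uI = unit_2_imp_integral_2[OF uu(1)]
  \<comment> \<open>Up to the factor 4, \<open>D\<close> and \<open>N\<close> are the denominator
    and numerator of the duplication formula, cleared by powers of \<open>2 ^ k = 2 * g\<close>.
    Each is a power of the unit \<open>u\<close> plus twice a 2-integral number.\<close>
  define D where "D = u^3 + 2 * (2 * a * u * g^2 + 4 * b * g^3)"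
  define N where "N = u^4 + 2 * (- (4 * a * u^2 * g^2) - 32 * b * u * g^3 + 8 * a^2 * g^4)"
  have D: "unit_2 D" unfolding D_def
    by (intro unit_2_add_even unit_2_power uu integral_2_intros ab uI g)
  have N: "unit_2 N" unfolding N_def
    by (intro unit_2_add_even unit_2_power uu integral_2_intros ab uI g)
  have y: "y^2 = x^3 + A * x + B" using P by (simp add: ec_points_def)
  have DE: "D = w^3 * y^2 * (2 * g)^3"
    unfolding D_def uu(2) a_def b_def y by (simp add: algebra_simps eval_nat_numeral)
  have NE: "N = w^4 * (2 * g)^4 * (x^4 - 2 * A * x^2 - 8 * B * x + A^2)"
    unfolding N_def uu(2) a_def b_def by (simp add: algebra_simps eval_nat_numeral)
  have y0: "y \<noteq> 0" using unit_2_nonzero[OF D] DE by auto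
  have "w * ((x^4 - 2 * A * x^2 - 8 * B * x + A^2) / (4 * y^2)) * 2 ^ (k + 2) = N / D"
  proof -
    have "g \<noteq> 0" by (simp add: g_def)
    then show ?thesis
      unfolding DE NE k using y0 w(1) by (simp add: field_simps g_def eval_nat_numeral)
  qed
  then have "unit_2 (w * ((x^4 - 2 * A * x^2 - 8 * B * x + A^2) / (4 * y^2)) * 2 ^ (k + 2))"
    using unit_2_divide[OF N D] by simp
  then show ?thesis using ec_double_affine[OF P y0] by blast
qed

text \<open>Powers grow by multiplication with \<open>P\<close> on the right, so once
  \<open>Infinity\<close> is reached at \<open>n\<close> the sequence starts again.\<close>

lemma ec_pow_mod:
  assumes "P [^]\<^bsub>ec_group A B\<^esub> (n::nat) = Infinity"
  shows "P [^]\<^bsub>ec_group A B\<^esub> m = P [^]\<^bsub>ec_group A B\<^esub> (m mod n)"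
proof -
  have 1: "P [^]\<^bsub>ec_group A B\<^esub> (n + j) = P [^]\<^bsub>ec_group A B\<^esub> j" for j
    by (induction j) (use assms in auto)
  have "P [^]\<^bsub>ec_group A B\<^esub> (n * q + j) = P [^]\<^bsub>ec_group A B\<^esub> j" for q j
    by (induction q) (simp_all add: 1 add.assoc)
  from this[of "m div n" "m mod n"] show ?thesis by simp
qed

text \<open>A point of finite order has finitely many multiples, whereas the multiples of
  \<open>P\<close> by \<open>2 ^ j * i\<close> have poles of the distinct orders
  \<open>k + 2 * j\<close>.\<close>

lemma ec_infinite_order_2:
  assumes ns: "ec_nonsingular A B" and P: "P \<in> ec_points A B"
    and w: "w \<noteq> 0" "integral_2 (w^2 * A)" "integral_2 (w^3 * B)"
    and i: "P [^]\<^bsub>ec_group A B\<^esub> (i::nat) = Affine x y"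
    and u: "unit_2 (w * x * 2 ^ k)" "k > 0"
    and n: "n > 0"
  shows "P [^]\<^bsub>ec_group A B\<^esub> (n::nat) \<noteq> Infinity"
proof
  assume tors: "P [^]\<^bsub>ec_group A B\<^esub> n = Infinity"
  define R where "R j = P [^]\<^bsub>ec_group A B\<^esub> (2 ^ j * i)" for j
  have R: "\<exists>x y. R j = Affine x y \<and> unit_2 (w * x * 2 ^ (k + 2 * j))" for j
  proof (induction j)
    case 0
    show ?case using i u by (simp add: R_def)
  next
    case (Suc j)
    then obtain x y where xy: "R j = Affine x y" "unit_2 (w * x * 2 ^ (k + 2 * j))" by blast
    have "R (Suc j) = ec_add A (R j) (R j)"
      using ec_pow_double[OF ns P, of "2 ^ j * i"] by (simp add: R_def mult.assoc)
    moreover have "Affine x y \<in> ec_points A B" using ec_pow_closed[OF P] xy(1) R_def by metis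
    from ec_double_pole_2[OF this w xy(2)] u(2) obtain x' y'
      where "ec_add A (Affine x y) (Affine x y) = Affine x' y'" "unit_2 (w * x' * 2 ^ (k + 2 * j + 2))"
      by auto
    ultimately show ?case using xy(1) by (simp add: add.assoc)
  qed
  have "inj R"
  proof
    fix j l assume "R j = R l"
    then show "j = l" using R[of j] R[of l] unit_2_pole_unique by fastforce
  qed
  moreover have "range R \<subseteq> (\<lambda>m. P [^]\<^bsub>ec_group A B\<^esub> m) ` {..<n}"
    using ec_pow_mod[OF tors] n by (auto simp: R_def intro!: image_eqI[of _ _ "_ mod n"])
  then have "finite (range R)" by (rule finite_subset) simp
  ultimately show False using finite_imageD by blast
qed

section \<open>The point of infinite order\<close>

lemma E4_infinite_order:
  fixes a b c :: rat
  assumes nz: "a * b * c \<noteq> 0" "a * c - b^2 \<noteq> 0" "3 * a * c - b^2 \<noteq> 0" "4 * a * c - b^2 \<noteq> 0"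
    and gen: "b^2 \<noteq> 3 / 2 * a * c"
  defines "P \<equiv> Affine (- (a^3 * c)) (a^3 * b * (3 * a * c - b^2))"
  shows "P \<in> ec_points (E4_A a b c) (E4_B a b c)"
    and "n > 0 \<Longrightarrow> P [^]\<^bsub>E4_group a b c\<^esub> (n::nat) \<noteq> Infinity"
proof -
  define A B e Y where "A = E4_A a b c" and "B = E4_B a b c" and "e = 3 * a * c - b^2"
    and "Y = a^3 * b * e"
  have ns: "ec_nonsingular A B" unfolding A_def B_def using nz by (rule E4_nonsingular)
  have abc: "a \<noteq> 0" "b \<noteq> 0" "c \<noteq> 0" "e \<noteq> 0" using nz by (auto simp: e_def)
  have Y0: "Y \<noteq> 0" using abc by (simp add: Y_def)
  have Adef: "A = - 3 * a^6 * c^2" by (simp add: A_def E4_A_def)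
  have Bdef: "B = - (a^6 * (2 * a * c - b^2) * (a^2 * c^2 - 4 * a * b^2 * c + b^4))"
    by (simp add: B_def E4_B_def)
  have Pdef: "P = Affine (- (a^3 * c)) Y" by (simp add: P_def Y_def e_def)
  have "Y^2 = (- (a^3 * c))^3 + A * (- (a^3 * c)) + B"
    unfolding Y_def e_def Adef Bdef by algebra
  then show P: "P \<in> ec_points (E4_A a b c) (E4_B a b c)"
    by (simp add: ec_points_def Pdef A_def B_def)
  note P = P[folded A_def B_def]

  \<comment> \<open>The factor \<open>w\<close> rescales first coordinates so that the curve becomes integral and the first
    coordinates of \<open>P\<close> and \<open>2P\<close> become \<open>- r\<close> and \<open>2 r\<close>.\<close>
  obtain r s where rs: "quotient_of (a * c / b^2) = (r, s)" by fastforce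
  then have cop: "coprime r s" and s_pos: "s > 0" and q: "a * c / b^2 = of_int r / of_int s"
    using quotient_of_coprime quotient_of_denom_pos quotient_of_div by blast+
  define R S where "R = rat_of_int r" and "S = rat_of_int s"
  define w where "w = S / (a^2 * b^2)"
  have S0: "S \<noteq> 0" using s_pos by (simp add: S_def)
  have w0: "w \<noteq> 0" using S0 abc by (simp add: w_def)
  have wR: "w * a^3 * c = R"
    using q S0 abc by (simp add: w_def R_def S_def field_simps eval_nat_numeral)
  have wS: "w * a^2 * b^2 = S" using abc by (simp add: w_def)
  have wE: "w * a^2 * e = 3 * R - S" unfolding wR[symmetric] wS[symmetric] e_def by algebra
  have R0: "R \<noteq> 0" using wR w0 abc by auto
  have E0: "3 * R - S \<noteq> 0" using wE w0 abc by auto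
  have G0: "3 * R - 2 * S \<noteq> 0"
  proof
    assume "3 * R - 2 * S = 0"
    moreover have "3 * R - 2 * S = w * a^2 * (3 * a * c - 2 * b^2)"
      unfolding wR[symmetric] wS[symmetric] by algebra
    ultimately have "w * a^2 * (3 * a * c - 2 * b^2) = 0" by simp
    then show False using w0 abc gen by auto
  qed
  define A' B' where "A' = - 3 * R^2" and "B' = - ((2 * R - S) * (R^2 - 4 * R * S + S^2))"
  have wA: "w^2 * A = A'" unfolding A'_def Adef wR[symmetric] by algebra
  have wB: "w^3 * B = B'" unfolding B'_def Bdef wR[symmetric] wS[symmetric] by algebra
  have int: "integral_2 R" "integral_2 S" by (simp_all add: R_def S_def)
  have intA: "integral_2 A'" and intB: "integral_2 B'"
    unfolding A'_def B'_def by (intro integral_2_intros int)+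
  have concl: "\<forall>n>0. P [^]\<^bsub>E4_group a b c\<^esub> (n::nat) \<noteq> Infinity"
    if "P [^]\<^bsub>ec_group A B\<^esub> (i::nat) = Affine x y" "unit_2 (w * x * 2 ^ k)" "k > 0" for i x y k
    using ec_infinite_order_2[OF ns P w0 _ _ that] wA wB intA intB
    by (simp add: E4_group_def A_def B_def)
  \<comment> \<open>The duplication formula in rescaled coordinates. The factor 4 is written as two
    nested factors 2 to fit \<open>unit_2_divide_even\<close>.\<close>
  have dbl: "\<exists>y'. P [^]\<^bsub>ec_group A B\<^esub> (2 * i) = Affine x' y' \<and>
      w * x' = ((w * x)^4 - 2 * A' * (w * x)^2 - 8 * B' * (w * x) + A'^2) / (2 * (2 * (w^3 * y^2)))"
    if "P [^]\<^bsub>ec_group A B\<^esub> (i::nat) = Affine x y" "y \<noteq> 0"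
      "x' = (x^4 - 2 * A * x^2 - 8 * B * x + A^2) / (4 * y^2)" for i x y x'
  proof -
    have "Affine x y \<in> ec_points A B" using ec_pow_closed[OF P, of i] that(1) by simp
    from ec_double_affine[OF this that(2)]
    have "\<exists>y'. P [^]\<^bsub>ec_group A B\<^esub> (2 * i) = Affine x' y'"
      using ec_pow_double[OF ns P, of i] that(1,3) by simp
    moreover define N where "N = x^4 - 2 * A * x^2 - 8 * B * x + A^2"
    have "(w * x)^4 - 2 * A' * (w * x)^2 - 8 * B' * (w * x) + A'^2 = w^4 * N"
      unfolding N_def wA[symmetric] wB[symmetric] by algebra
    then have "w * x' = ((w * x)^4 - 2 * A' * (w * x)^2 - 8 * B' * (w * x) + A'^2) /
        (2 * (2 * (w^3 * y^2)))"
      using w0 unfolding that(3) N_def[symmetric] by (simp add: eval_nat_numeral)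
    ultimately show ?thesis by blast
  qed

  \<comment> \<open>The tangent at \<open>P\<close> has slope 0 because
    \<open>3 * (a^3 * c)^2 = - A\<close>.\<close>
  have "ec_add A P P = Affine (0^2 - - (a^3 * c) - - (a^3 * c))
      (0 * (- (a^3 * c) - (0^2 - - (a^3 * c) - - (a^3 * c))) - Y)"
    unfolding Pdef by (rule ec_add_tangent[OF Y0]) (unfold Adef, algebra)
  then have P2: "P [^]\<^bsub>ec_group A B\<^esub> (2::nat) = Affine (2 * a^3 * c) (- Y)"
    by (simp add: numeral_2_eq_2)
  have wY: "w^3 * Y^2 = S * (3 * R - S)^2"
    unfolding wR[symmetric] wS[symmetric] Y_def e_def by algebra

  \<comment> \<open>The multiple with a pole at 2 is \<open>4P\<close> if \<open>r\<close> is odd, \<open>3P\<close> if \<open>4\<close> divides \<open>r\<close>, and \<open>6P\<close>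
    otherwise; only in the last case can it be the point at infinity.\<close>
  show "n > 0 \<Longrightarrow> P [^]\<^bsub>E4_group a b c\<^esub> (n::nat) \<noteq> Infinity"
  proof (cases "odd r")
    case True
    from dbl[OF P2 _ refl] Y0 obtain x y where x: "P [^]\<^bsub>ec_group A B\<^esub> (2 * 2 :: nat) = Affine x y"
      "w * x = ((w * (2 * a^3 * c))^4 - 2 * A' * (w * (2 * a^3 * c))^2 - 8 * B' * (w * (2 * a^3 * c)) + A'^2)
        / (2 * (2 * (w^3 * (- Y)^2)))" by auto
    have w2: "w * (2 * a^3 * c) = 2 * R" using wR by (simp add: mult_ac)
    have "w * x = ((2 * R)^4 - 2 * A' * (2 * R)^2 - 8 * B' * (2 * R) + A'^2)
        / (2 * (2 * (S * (3 * R - S)^2)))" using x(2) unfolding w2 power2_minus wY .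
    \<comment> \<open>Division by the denominator leaves the remainder \<open>81 * R^4\<close>, a
      unit at 2 for odd \<open>r\<close>, and the integral quotient
      \<open>- (4 * R)\<close>.\<close>
    also have "(2 * R)^4 - 2 * A' * (2 * R)^2 - 8 * B' * (2 * R) + A'^2 =
        81 * R^4 + - (4 * R) * (2 * (2 * (S * (3 * R - S)^2)))"
      unfolding A'_def B'_def by algebra
    also have "\<dots> / (2 * (2 * (S * (3 * R - S)^2))) = 81 * R^4 / (2 * (2 * (S * (3 * R - S)^2))) + - (4 * R)"
      using S0 E0 by (subst add_divide_distrib) simp
    finally have wx: "w * x = 81 * R^4 / (2 * (2 * (S * (3 * R - S)^2))) + - (4 * R)" .
    have "unit_2 (81 * R^4)"
      using unit_2_of_int[of "81 * r^4"] True by (simp add: R_def)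
    moreover have "integral_2 (2 * (S * (3 * R - S)^2))" by (intro integral_2_intros int)
    moreover have "2 * (S * (3 * R - S)^2) \<noteq> 0" using S0 E0 by simp
    ultimately obtain k where k: "k > 0" "unit_2 (81 * R^4 / (2 * (2 * (S * (3 * R - S)^2))) * 2 ^ k)"
      using unit_2_divide_even by blast
    have "unit_2 (w * x * 2 ^ k)"
      unfolding wx by (intro unit_2_pole_add k integral_2_intros int)
    then show "n > 0 \<Longrightarrow> ?thesis" using concl x(1) k(1) by blast
  next
    case False
    then have s: "odd s" using cop by auto
    from False obtain v where v: "r = 2 * v" by auto
    define V where "V = rat_of_int v"
    have RV: "R = 2 * V" by (simp add: R_def V_def v)
    have V0: "V \<noteq> 0" using RV R0 by auto
    \<comment> \<open>The slope of the chord through \<open>2P\<close> and \<open>P\<close>, whose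
      second coordinates are \<open>- Y\<close> and \<open>Y\<close>.\<close>
    define m where "m = - (2 * b * e) / (3 * c)"
    have "2 * a^3 * c \<noteq> - (a^3 * c)" using abc by (simp add: eq_neg_iff_add_eq_0)
    moreover have m: "m * (- (a^3 * c) - 2 * a^3 * c) = Y - - Y"
      using abc by (simp add: m_def Y_def field_simps)
    moreover define x3 y3 where "x3 = m^2 - 2 * a^3 * c - - (a^3 * c)"
      and "y3 = m * (2 * a^3 * c - x3) - - Y"
    ultimately have "ec_add A (Affine (2 * a^3 * c) (- Y)) P = Affine x3 y3"
      unfolding Pdef by (subst ec_add_chord) auto
    then have P3: "P [^]\<^bsub>ec_group A B\<^esub> (3::nat) = Affine x3 y3"
      using P2 by (simp add: eval_nat_numeral)
    have "w * m^2 * (9 * V^2) = S * (3 * R - S)^2"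
    proof -
      have "m * (3 * c) = - (2 * b * e)" using abc by (simp add: m_def)
      then have "9 * w * m^2 * R^2 = 4 * (S * (3 * R - S)^2)"
        unfolding wR[symmetric] wS[symmetric] e_def by algebra
      then show ?thesis by (simp add: RV power_mult_distrib mult_ac)
    qed
    then have "w * m^2 = S * (3 * R - S)^2 / (9 * V^2)" using V0 by (simp add: field_simps)
    \<comment> \<open>The first summand decides the behaviour at 2: its numerator is odd, since
      \<open>r\<close> is even and \<open>s\<close> odd, and its denominator is even exactly when 4
      divides \<open>r\<close>.\<close>
    then have wx3: "w * x3 = S * (3 * R - S)^2 / (9 * V^2) + 2 * (- V)"
      using wR RV unfolding x3_def by (simp add: algebra_simps)
    have uS: "unit_2 (S * (3 * R - S)^2)"
      using unit_2_of_int[of "s * (3 * r - s)^2"] s False by (simp add: R_def S_def)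
    show "n > 0 \<Longrightarrow> ?thesis"
    proof (cases "even v")
      case True
      then obtain u where u: "v = 2 * u" by auto
      have VU: "9 * V^2 = 2 * (of_int (18 * u^2))" by (simp add: V_def u power_mult_distrib)
      have "of_int (18 * u^2) \<noteq> (0::rat)" using VU V0 by auto
      then obtain k where k: "k > 0" "unit_2 (S * (3 * R - S)^2 / (9 * V^2) * 2 ^ k)"
        using unit_2_divide_even[OF uS integral_2_of_int] unfolding VU by blast
      have "unit_2 (w * x3 * 2 ^ k)"
        unfolding wx3 by (intro unit_2_pole_add k integral_2_intros) (simp add: V_def)
      then show "n > 0 \<Longrightarrow> ?thesis" using concl P3 k(1) by blast
    next
      case False
      \<comment> \<open>For odd \<open>v\<close> the rescaled first coordinate \<open>X\<close> of
        \<open>3P\<close> is a unit. Doubling then gives an odd numerator over an even denominator,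
        provided that \<open>3P\<close> is not of order 2.\<close>
      define X where "X = w * x3"
      have "unit_2 (S * (3 * R - S)^2 / (9 * V^2))"
        using unit_2_of_int[of "9 * v^2"] False by (intro unit_2_divide uS) (simp add: V_def)
      then have uX: "unit_2 X"
        unfolding X_def wx3 by (rule unit_2_add_even) (simp add: V_def integral_2_uminus)
      \<comment> \<open>In terms of \<open>R\<close> and \<open>S\<close>, vanishing of
        \<open>y3\<close> forces
        \<open>(3 * R - 2 * S) * (9 * R^2 - 18 * R * S + 4 * S^2) = 0\<close>. The first factor is
        nonzero by \<open>gen\<close>; for \<open>R = 2 * V\<close> the second is four times an odd
        integer.\<close>
      have y3: "y3 \<noteq> 0"
      proof
        assume "y3 = 0"
        then have "m^3 + Y = 0" using m unfolding y3_def x3_def by algebra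
        moreover have m3: "m * (3 * c) = - (2 * b * e)" using abc by (simp add: m_def)
        ultimately have "27 * c^3 * Y = 8 * (b * e)^3" by algebra
        then have "b * e * (27 * (a * c)^3 - 8 * b^2 * e^2) = 0" unfolding Y_def by algebra
        then have "27 * (a * c)^3 - 8 * b^2 * e^2 = 0" using abc by simp
        then have "(3 * R - 2 * S) * (9 * R^2 - 18 * R * S + 4 * S^2) = 0"
          unfolding wR[symmetric] wS[symmetric] e_def by algebra
        then have "9 * R^2 - 18 * R * S + 4 * S^2 = 0" using G0 by simp
        then have "rat_of_int (4 * (9 * v^2 - 9 * v * s + s^2)) = of_int 0"
          using RV by (simp add: V_def S_def algebra_simps power_mult_distrib)
        then have "4 * (9 * v^2 - 9 * v * s + s^2) = 0" by (simp only: of_int_eq_iff)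
        then have "9 * v^2 - 9 * v * s + s^2 = 0" by simp
        moreover have "odd (9 * v^2 - 9 * v * s + s^2)" using False s by simp
        ultimately show False by simp
      qed
      from dbl[OF P3 y3 refl] obtain x y where x: "P [^]\<^bsub>ec_group A B\<^esub> (2 * 3 :: nat) = Affine x y"
        "w * x = (X^4 - 2 * A' * X^2 - 8 * B' * X + A'^2) / (2 * (2 * (w^3 * y3^2)))"
        unfolding X_def by blast
      have Ni: "X^4 - 2 * A' * X^2 - 8 * B' * X + A'^2 = X^4 + 2 * (12 * V^2 * X^2 - 4 * B' * X + 72 * V^4)"
        unfolding A'_def RV by algebra
      have iV: "integral_2 V" by (simp add: V_def)
      note iX = unit_2_imp_integral_2[OF uX]
      have N: "unit_2 (X^4 - 2 * A' * X^2 - 8 * B' * X + A'^2)"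
        unfolding Ni by (intro unit_2_add_even unit_2_power uX integral_2_intros iV iX intB)
      have "y3^2 = x3^3 + A * x3 + B"
        using ec_pow_closed[OF P, of 3] P3 by (simp add: ec_points_def)
      then have D: "w^3 * y3^2 = X^3 + A' * X + B'"
        unfolding X_def wA[symmetric] wB[symmetric] by algebra
      have "integral_2 (2 * (w^3 * y3^2))"
        unfolding D by (intro integral_2_intros iX intA intB)
      from unit_2_divide_even[OF N this] w0 y3 obtain k where "k > 0" "unit_2 (w * x * 2 ^ k)"
        unfolding x(2) by auto
      then show "n > 0 \<Longrightarrow> ?thesis" using concl x(1) by blast
    qed
  qed
qed

lemma E4_rank_pos:
  fixes a b c :: rat
  assumes "a * b * c \<noteq> 0" "a * c - b^2 \<noteq> 0" "3 * a * c - b^2 \<noteq> 0" "4 * a * c - b^2 \<noteq> 0"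
    and "b^2 \<noteq> 3 / 2 * a * c"
  shows "abelian_rank (E4_group a b c) > 0"
  using abelian_rank_ec_pos[OF E4_nonsingular[OF assms(1-4)] E4_infinite_order(1)[OF assms]]
    E4_infinite_order(2)[OF assms]
  by (simp add: E4_group_def)

section \<open>The curve of conductor 20\<close>

lemma coprime_mult_eq_power_int:
  fixes u v y :: int
  assumes "u \<ge> 0" "v \<ge> 0" "coprime u v" "u * v = y ^ n" "y \<ge> 0" "n > 0"
  shows "\<exists>p q. p \<ge> 0 \<and> q \<ge> 0 \<and> u = p ^ n \<and> v = q ^ n \<and> p * q = y"
proof -
  obtain u' v' y' where n: "u = int u'" "v = int v'" "y = int y'"
    using assms by (metis zero_le_imp_eq_int)
  have "coprime u' v'" "u' * v' = y' ^ n"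
    using assms by (simp_all add: n flip: of_nat_mult of_nat_power)
  then have "is_nth_power n u' \<and> is_nth_power n v'"
    using is_nth_power_mult_coprime_nat_iff[of u' v' n] by auto
  then obtain p q where pq: "u' = p ^ n" "v' = q ^ n" by (auto elim!: is_nth_powerE)
  then have "(p * q) ^ n = y' ^ n" using \<open>u' * v' = y' ^ n\<close> by (simp add: power_mult_distrib)
  then have "p * q = y'" using assms(6) by (simp add: power_eq_iff_eq_base)
  then show ?thesis
    using pq by (intro exI[of _ "int p"] exI[of _ "int q"]) (auto simp: n)
qed

text \<open>The prime 5 divides one of the coprime factors, and after removing it both are fourth
  powers. Stating the result for the sum covers both positions of the 5.\<close>

lemma coprime_mult_eq_5_fourth_power:
  fixes u v y :: int
  assumes "u \<ge> 0" "v \<ge> 0" "coprime u v" "u * v = 5 * y ^ 4" "y \<ge> 0"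
  shows "\<exists>p q. p \<ge> 0 \<and> q \<ge> 0 \<and> u + v = 5 * p ^ 4 + q ^ 4 \<and> coprime p q \<and> p * q = y"
proof -
  have *: "\<exists>p q. p \<ge> 0 \<and> q \<ge> 0 \<and> u + v = 5 * p ^ 4 + q ^ 4 \<and> coprime p q \<and> p * q = y"
    if uv: "u \<ge> 0" "v \<ge> 0" "coprime u v" "u * v = 5 * y ^ 4" and "5 dvd u" for u v :: int
  proof -
    obtain w where w: "u = 5 * w" using \<open>5 dvd u\<close> by blast
    have "w \<ge> 0" "coprime w v" "w * v = y ^ 4" using uv by (auto simp: w)
    then obtain p q where pq: "p \<ge> 0" "q \<ge> 0" "w = p ^ 4" "v = q ^ 4" "p * q = y"
      using coprime_mult_eq_power_int[of w v y 4] uv assms(5) by auto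
    then have "coprime p q" using \<open>coprime w v\<close> by simp
    then show ?thesis using pq w by auto
  qed
  have "prime (5::int)" by simp
  then have "5 dvd u \<or> 5 dvd v" using assms(4) by (metis dvd_triv_left prime_dvd_mult_iff)
  then show ?thesis
    using *[of u v] *[of v u] assms by (auto simp: ac_simps)
qed

text \<open>Holds because 5 is squarefree. In the descents a prime common to both factors of
  \<open>5 * y^4\<close> has its square dividing the product, hence divides
  \<open>y\<close>.\<close>

lemma prime_square_dvd_5_fourth_power:
  fixes p y :: int
  assumes "prime p" "p * p dvd 5 * y ^ 4"
  shows "p dvd y"
proof (rule ccontr)
  assume "\<not> p dvd y"
  then have "coprime (p * p) (y ^ 4)" using assms(1) by (simp add: prime_imp_coprime)
  then have "p * p dvd 5" using assms(2) by (simp add: coprime_dvd_mult_left_iff)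
  then have "p * p \<le> 5" by (rule zdvd_imp_le) simp
  moreover have "p \<ge> 2" using assms(1) by (rule prime_ge_2_int)
  ultimately have "p = 2" using mult_mono[of 3 p 3 p] by linarith
  then show False using \<open>p * p dvd 5\<close> by simp
qed

lemma square_mod_4: "(x::int)^2 mod 4 = (if even x then 0 else 1)"
proof (cases "even x")
  case True
  then obtain k where "x = 2 * k" by blast
  then show ?thesis by (simp add: power_mult_distrib)
next
  case False
  then obtain k where "x = 2 * k + 1" by (rule oddE)
  then have "x^2 = 4 * (k^2 + k) + 1" by (simp add: power2_eq_square algebra_simps)
  then have "x^2 mod 4 = 1" by presburger
  then show ?thesis using False by simp
qed

lemma coprime_intI_prime:
  fixes u v :: int
  assumes "\<And>p. prime p \<Longrightarrow> p dvd u \<Longrightarrow> p dvd v \<Longrightarrow> False"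
  shows "coprime u v"
proof (rule ccontr)
  assume "\<not> coprime u v"
  then have "gcd u v \<noteq> 1" by (simp add: coprime_iff_gcd_eq_1)
  then have "\<not> is_unit (gcd u v)" by simp
  then obtain p where "prime p" "p dvd gcd u v"
    using prime_divisor_exists[of "gcd u v"] assms[of 2] by (cases "gcd u v = 0") auto
  then show False using assms by auto
qed

text \<open>Both descents write the equation as \<open>(2x^2 + y^2)^2 - (2z)^2 = 5y^4\<close>, which splits \<open>y\<close>
  (or \<open>y/2\<close>) as \<open>A B\<close>; a second factorization splits \<open>A\<close> as \<open>k l\<close>, where
  \<open>(k, l, B)\<close> solves the original equation.\<close>

lemma quartic_no_even_solution:
  fixes x y z :: int
  assumes "x^4 + x^2 * y^2 = z^2 + y^4" "coprime x y" "x > 0" "y > 0" "z \<ge> 0" "even y"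
  shows False
  using assms
proof (induction "nat y" arbitrary: x y z rule: less_induct)
  case less
  note eq = less.prems(1) and cop = less.prems(2)
  have nod: False if "prime p" "p dvd x" "p dvd y" for p
    using that cop by (meson coprime_common_divisor not_prime_unit)
  obtain Y where y: "y = 2 * Y" using less.prems(6) by blast
  have xodd: "odd x" using nod[of 2] less.prems(6) by auto
  have "odd (z^2 + y^4)" unfolding eq[symmetric] using xodd less.prems(6) by simp
  then have zodd: "odd z" using less.prems(6) by simp
  \<comment> \<open>Half of \<open>2 * x^2 + y^2\<close>. Since \<open>M\<close> and
    \<open>z\<close> are odd, \<open>M^2 - z^2 = 20 * Y^4\<close> can be divided by 4, with integral
    factors \<open>u = (M - z) / 2\<close> and \<open>z + u = (M + z) / 2\<close>.\<close>
  define M where "M = x^2 + 2 * Y^2"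
  have M: "M^2 = z^2 + 20 * Y^4" using eq unfolding M_def y by algebra
  have "z^2 \<le> M^2" unfolding M by simp
  then have zM: "z \<le> M" by (rule power2_le_imp_le) (simp add: M_def)
  have "even (M - z)" using xodd zodd by (simp add: M_def)
  then obtain u where u: "M - z = 2 * u" by blast
  have u0: "u \<ge> 0" using u zM by simp
  have uv: "u * (z + u) = 5 * Y^4"
  proof -
    have "M = z + 2 * u" using u by simp
    then have "4 * (u * (z + u)) = 4 * (5 * Y^4)" using M by algebra
    then show ?thesis by simp
  qed
  have "coprime u (z + u)"
  proof (rule coprime_intI_prime)
    fix p assume p: "prime p" "p dvd u" "p dvd z + u"
    then have "p * p dvd 5 * Y^4" unfolding uv[symmetric] by (intro mult_dvd_mono)
    then have pY: "p dvd Y" using p(1) prime_square_dvd_5_fourth_power by blast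
    have "p dvd u + (z + u)" using p(2,3) by (rule dvd_add)
    also have "u + (z + u) = x^2 + Y * (2 * Y)" using u M_def by (simp add: power2_eq_square)
    finally have "p dvd x^2" using pY by (simp add: dvd_add_left_iff)
    then show False using nod[OF p(1)] pY p(1) y prime_dvd_power by (metis dvd_mult)
  qed
  then obtain A B where AB: "A \<ge> 0" "B \<ge> 0" "u + (z + u) = 5 * A^4 + B^4" "coprime A B" "A * B = Y"
    using coprime_mult_eq_5_fourth_power[OF u0 _ _ uv] u0 less.prems y by auto
  have Ax: "A dvd y" using AB(5) y by auto
  have "A \<noteq> 0" "B \<noteq> 0" using AB(5) y less.prems(4) by auto
  then have pos: "A > 0" "B > 0" using AB by auto
  have xAB: "x^2 + 2 * A^2 * B^2 = 5 * A^4 + B^4"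
    using AB(3) u unfolding M_def AB(5)[symmetric] by (simp add: power_mult_distrib)
  have "odd (5 * A^4 + B^4)" unfolding xAB[symmetric] using xodd by simp
  then have ABodd: "odd (A + B)" by simp
  \<comment> \<open>The second factorization: \<open>xAB\<close> says
    \<open>x^2 - (A^2 - B^2)^2 = 4 * A^4\<close>, and \<open>f\<close>, \<open>g\<close> are the
    halves of the two factors on the left.\<close>
  have "even (x - (A^2 - B^2))" using xodd ABodd by auto
  then obtain f where f: "x - (A^2 - B^2) = 2 * f" by blast
  define g where "g = x - f"
  have fg: "f * g = A^4"
  proof -
    have "x = A^2 - B^2 + 2 * f" using f by simp
    then have "4 * (f * g) = 4 * A^4" using xAB unfolding g_def by algebra
    then show ?thesis by simp
  qed
  have fgpos: "f > 0" "g > 0"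
  proof -
    have "f * g > 0" using fg pos by simp
    moreover have "f + g > 0" using g_def less.prems(3) by simp
    ultimately show "f > 0" "g > 0" by (auto simp: zero_less_mult_iff)
  qed
  have "coprime f g"
  proof (rule coprime_intI_prime)
    fix p assume p: "prime p" "p dvd f" "p dvd g"
    then have "p dvd A^4" unfolding fg[symmetric] by simp
    then have "p dvd y" using p(1) Ax prime_dvd_power dvd_trans by blast
    moreover have "p dvd x" using dvd_add[OF p(2,3)] by (simp add: g_def)
    ultimately show False using nod p(1) by blast
  qed
  then obtain k l where kl: "k \<ge> 0" "l \<ge> 0" "f = k^4" "g = l^4" "k * l = A"
    using coprime_mult_eq_power_int[OF _ _ _ fg] fgpos pos by auto
  have "g - f = A^2 - B^2" using f g_def by simp
  then have new: "k^4 + k^2 * l^2 = B^2 + l^4"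
    unfolding kl(3,4) kl(5)[symmetric] by (simp add: power_mult_distrib)
  \<comment> \<open>The new solution must again be of the even kind. As exactly one of
    \<open>A = k * l\<close> and \<open>B\<close> is odd, an odd \<open>l\<close> contradicts the
    equation modulo 4 if \<open>k\<close> is even and modulo 2 if \<open>k\<close> is odd.\<close>
  have "even l"
  proof (rule ccontr)
    assume l: "odd l"
    show False
    proof (cases "even k")
      case True
      then have "odd B" using ABodd kl(5) by auto
      have "(B^2 + (l^2)^2) mod 4 = (B^2 mod 4 + (l^2)^2 mod 4) mod 4" by (simp only: mod_add_eq)
      also have "\<dots> = 2" using \<open>odd B\<close> l by (simp only: square_mod_4) simp
      finally have "(B^2 + l^4) mod 4 = 2" by simp
      moreover have "(k^4 + k^2 * l^2) mod 4 = 0" using True by auto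
      ultimately show False using new by simp
    next
      case False
      then have "even B" using ABodd kl(5) l by auto
      then have "odd (B^2 + l^4)" using l by simp
      then show False unfolding new[symmetric] using False l by simp
    qed
  qed
  moreover have "coprime k l" using \<open>coprime f g\<close> kl(3,4) by simp
  moreover have "k > 0" "l > 0" using kl pos by (auto simp: less_le)
  moreover have "nat l < nat y"
  proof -
    have "l dvd Y" using kl(5) AB(5) by auto
    then have "l \<le> Y" using y less.prems(4) by (intro zdvd_imp_le) auto
    then show ?thesis using y less.prems(4) by simp
  qed
  ultimately show False using less.hyps[of l k B] new AB(2) by blast
qed

lemma quartic_odd_solution:
  fixes x y z :: int
  assumes "x^4 + x^2 * y^2 = z^2 + y^4" "coprime x y" "x > 0" "y > 0" "z \<ge> 0" "odd x" "odd y"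
  shows "x = 1 \<and> y = 1"
  using assms
proof (induction "nat y" arbitrary: x y z rule: less_induct)
  case less
  note eq = less.prems(1) and cop = less.prems(2)
  have nod: False if "prime p" "p dvd x" "p dvd y" for p
    using that cop by (meson coprime_common_divisor not_prime_unit)
  define M where "M = 2 * x^2 + y^2"
  have M: "M^2 = (2 * z)^2 + 5 * y^4" using eq unfolding M_def by algebra
  have "(2 * z)^2 \<le> M^2" unfolding M by simp
  then have zM: "2 * z \<le> M" by (rule power2_le_imp_le) (simp add: M_def)
  define u where "u = M - 2 * z"
  have u0: "u \<ge> 0" using zM by (simp add: u_def)
  have uodd: "odd u" using less.prems(7) by (simp add: u_def M_def)
  have uv: "u * (M + 2 * z) = 5 * y^4" using M unfolding u_def by algebra
  have "coprime u (M + 2 * z)"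
  proof (rule coprime_intI_prime)
    fix p assume p: "prime p" "p dvd u" "p dvd M + 2 * z"
    then have "p * p dvd 5 * y^4" unfolding uv[symmetric] by (intro mult_dvd_mono)
    then have py: "p dvd y" using p(1) prime_square_dvd_5_fourth_power by blast
    have "p dvd u + (M + 2 * z)" using p(2,3) by (rule dvd_add)
    also have "u + (M + 2 * z) = 4 * x^2 + y * (2 * y)" by (simp add: u_def M_def power2_eq_square)
    finally have "p dvd 2^2 * x^2" using py by (simp add: dvd_add_left_iff)
    then have "p dvd 2 \<or> p dvd x" using p(1) by (metis prime_dvd_mult_iff prime_dvd_power)
    moreover have "\<not> p dvd 2" using p uodd primes_dvd_imp_eq[of p 2] by auto
    ultimately show False using nod[OF p(1)] py by blast
  qed
  then obtain A B where AB: "A \<ge> 0" "B \<ge> 0" "u + (M + 2 * z) = 5 * A^4 + B^4" "coprime A B" "A * B = y"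
    using coprime_mult_eq_5_fourth_power[OF u0 _ _ uv] less.prems by (auto simp: M_def)
  have odd: "odd A" "odd B" using AB(5) less.prems(7) by auto
  have pos: "A > 0" "B > 0" using AB odd by (auto simp: less_le)
  have xAB: "4 * x^2 + 2 * A^2 * B^2 = 5 * A^4 + B^4"
    using AB(3) unfolding u_def M_def AB(5)[symmetric] by (simp add: power_mult_distrib)
  \<comment> \<open>Now \<open>xAB\<close> becomes the Pythagorean equation
    \<open>x^2 = (2 * e)^2 + (A^2)^2\<close>. Solving it gives \<open>A^2 = r^2 - s^2\<close> with
    \<open>s * r = \<bar>e\<bar>\<close>, which is factored once more.\<close>
  have "4 dvd A^2 - B^2" using odd by (simp add: mod_eq_dvd_iff[symmetric] square_mod_4)
  then obtain e where e: "A^2 - B^2 = 4 * e" by blast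
  have xA: "x^2 = (2 * e)^2 + (A^2)^2"
  proof -
    have "4 * x^2 = (4 * e)^2 + 4 * A^4" using xAB unfolding e[symmetric] by algebra
    then show ?thesis by (simp add: power_mult_distrib)
  qed
  then have "(A^2)^2 \<le> x^2" by simp
  then have Ax: "A^2 \<le> x" by (rule power2_le_imp_le) (use less.prems in simp)
  have "even (x - A^2)" using less.prems(6) odd by simp
  then obtain f where f: "x - A^2 = 2 * f" by blast
  have f0: "f \<ge> 0" using f Ax by simp
  have fe: "f * (f + A^2) = \<bar>e\<bar>^2"
  proof -
    have "x = A^2 + 2 * f" using f by simp
    then have "4 * (f * (f + A^2)) = 4 * e^2" using xA by algebra
    then show ?thesis by simp
  qed
  have "coprime f (f + A^2)"
  proof (rule coprime_intI_prime)
    fix p assume p: "prime p" "p dvd f" "p dvd f + A^2"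
    then have pA: "p dvd A" using prime_dvd_power by (metis dvd_add_right_iff)
    then have "p dvd y" using AB(5) by auto
    moreover have "x = 2 * f + A * A" using f by (simp add: power2_eq_square)
    then have "p dvd x" using p(2) pA by simp
    ultimately show False using nod p(1) by blast
  qed
  then obtain s r where sr: "s \<ge> 0" "r \<ge> 0" "f = s^2" "f + A^2 = r^2" "s * r = \<bar>e\<bar>"
    using coprime_mult_eq_power_int[OF _ _ _ fe] f0 by auto
  have cop_sr: "coprime s r" using \<open>coprime f (f + A^2)\<close> unfolding sr(4) unfolding sr(3) by simp
  have "s^2 < r^2" using sr(3) sr(4)[symmetric] pos by simp
  then have "s < r" using sr(2) by (rule power2_less_imp_less)
  have rs: "(r - s) * (r + s) = A^2" using sr(3,4) by (simp add: power2_eq_square algebra_simps)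
  have "coprime (r - s) (r + s)"
  proof (rule coprime_intI_prime)
    fix p assume p: "prime p" "p dvd r - s" "p dvd r + s"
    then have "p dvd A^2" unfolding rs[symmetric] by simp
    then have "\<not> p dvd 2" using p(1) odd primes_dvd_imp_eq[of p 2] by auto
    moreover have "p dvd 2 * r" "p dvd 2 * s"
      using dvd_add[OF p(2,3)] dvd_diff[OF p(3,2)] by simp_all
    ultimately have "p dvd r" "p dvd s" using p(1) by (auto simp: prime_dvd_mult_iff)
    then show False using cop_sr p(1) by (meson coprime_common_divisor not_prime_unit)
  qed
  then obtain l k where lk: "l \<ge> 0" "k \<ge> 0" "r - s = l^2" "r + s = k^2" "l * k = A"
    using coprime_mult_eq_power_int[OF _ _ _ rs] \<open>s < r\<close> sr pos by auto
  have cop_lk: "coprime l k" using \<open>coprime (r - s) (r + s)\<close> unfolding lk(3,4) by simp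
  have "4 * \<bar>e\<bar> = k^4 - l^4"
  proof -
    have "4 * (s * r) = (r + s)^2 - (r - s)^2" by algebra
    then show ?thesis unfolding lk(3,4) sr(5) by simp
  qed
  \<comment> \<open>The sign of \<open>e\<close> is unknown; the two signs give the same equation
    with \<open>k\<close> and \<open>l\<close> exchanged.\<close>
  then have "k^4 - l^4 = A^2 - B^2 \<or> l^4 - k^4 = A^2 - B^2" using e by linarith
  then have "\<exists>k l. k \<ge> 0 \<and> l \<ge> 0 \<and> k * l = A \<and> coprime k l \<and> k^4 + k^2 * l^2 = B^2 + l^4"
  proof
    assume "k^4 - l^4 = A^2 - B^2"
    then have "l^4 + l^2 * k^2 = B^2 + k^4" unfolding lk(5)[symmetric] by (simp add: power_mult_distrib)
    then show ?thesis using lk cop_lk by blast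
  next
    assume "l^4 - k^4 = A^2 - B^2"
    then have "k^4 + k^2 * l^2 = B^2 + l^4"
      unfolding lk(5)[symmetric] by (simp add: power_mult_distrib mult_ac)
    then show ?thesis using lk cop_lk by (metis coprime_commute mult.commute)
  qed
  then obtain k l where kl: "k \<ge> 0" "l \<ge> 0" "k * l = A" "coprime k l" "k^4 + k^2 * l^2 = B^2 + l^4"
    by blast
  have kl_odd: "odd k" "odd l" using odd kl(3) by auto
  have kl_pos: "k > 0" "l > 0" using kl pos by (auto simp: less_le)
  have "l dvd y" using kl(3) AB(5) by auto
  then have ly: "l \<le> y" using less.prems(4) by (rule zdvd_imp_le)
  \<comment> \<open>The descent may fail to be strict: \<open>l = y\<close> forces
    \<open>k = B = 1\<close>, and the equation becomes \<open>l^2 = l^4\<close>.\<close>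
  have "A = 1 \<and> B = 1"
  proof (cases "l < y")
    case True
    then have "k = 1" "l = 1"
      using less.hyps[of l k B] kl kl_pos kl_odd AB(2) by auto
    then show ?thesis using kl pos by (auto simp: power2_eq_1_iff)
  next
    case False
    then have "l * (k * B) = l * 1" using ly kl(3) AB(5) by (simp add: mult_ac)
    then have "k * B = 1" using kl_pos by simp
    then have kB: "k = 1" "B = 1" using kl_pos pos by (simp_all add: zmult_eq_1_iff)
    have "l^2 * (l^2 - 1) = l^4 - l^2" by algebra
    also have "\<dots> = 0" using kl(5) kB by simp
    finally have "l^2 * (l^2 - 1) = 0" .
    then have "l^2 = 1" using kl_pos by simp
    then show ?thesis using kB kl(3) kl_pos by (auto simp: power2_eq_1_iff)
  qed
  then show ?case using AB(5) xAB less.prems(3) by (auto simp: power2_eq_1_iff)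
qed

text \<open>What remains is \<open>x\<close> even and \<open>y\<close> odd: then \<open>z\<close> is
  odd, the right side is 2 modulo 4 and the left side is 0.\<close>

lemma quartic_solution:
  fixes x y z :: int
  assumes "x^4 + x^2 * y^2 = z^2 + y^4" "coprime x y" "x > 0" "y > 0" "z \<ge> 0"
  shows "x = 1 \<and> y = 1"
proof (cases "even y")
  case True
  then show ?thesis using quartic_no_even_solution assms by blast
next
  case False
  have "odd x"
  proof
    assume "even x"
    then have "odd z" using arg_cong[OF assms(1), of even] False by simp
    have "(z^2 + (y^2)^2) mod 4 = (z^2 mod 4 + (y^2)^2 mod 4) mod 4" by (simp only: mod_add_eq)
    also have "\<dots> = 2" using \<open>odd z\<close> False by (simp only: square_mod_4) simp
    finally have "(z^2 + y^4) mod 4 = 2" by simp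
    moreover have "(x^4 + x^2 * y^2) mod 4 = 0" using \<open>even x\<close> by auto
    ultimately show False using assms(1) by simp
  qed
  then show ?thesis using quartic_odd_solution assms False by blast
qed

text \<open>The factors \<open>m\<close>, \<open>n\<close> and \<open>m^2 + m * n - n^2\<close> are
  pairwise coprime with a square product, so each is a square; square roots of \<open>m\<close> and
  \<open>n\<close> solve the quartic equation.\<close>

lemma square_product_solution:
  fixes m n k :: int
  assumes "k^2 = m * n * (m^2 + m * n - n^2)" "coprime m n" "m > 0" "n > 0"
  shows "m = 1 \<and> n = 1"
proof -
  define C where "C = m^2 + m * n - n^2"
  have C: "m * n * C = \<bar>k\<bar>^2" using assms(1) by (simp add: C_def)
  have "m * n * C \<ge> 0" unfolding C by simp
  moreover have "m * n > 0" using assms(3,4) by simp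
  ultimately have "C \<ge> 0" by (simp only: zero_le_mult_iff) linarith
  have "coprime (m * n) C"
  proof (rule coprime_intI_prime)
    fix p assume p: "prime p" "p dvd m * n" "p dvd C"
    have "p dvd m \<and> p dvd n"
    proof (cases "p dvd m")
      case True
      have "n^2 = m * (m + n) - C" by (simp add: C_def algebra_simps power2_eq_square)
      then have "p dvd n^2" using True p(3) by simp
      then show ?thesis using True p(1) prime_dvd_power by blast
    next
      case False
      then have "p dvd n" using p(1,2) by (simp add: prime_dvd_mult_iff)
      have "m^2 = C + n * (n - m)" by (simp add: C_def algebra_simps power2_eq_square)
      then have "p dvd m^2" using \<open>p dvd n\<close> p(3) by simp
      then show ?thesis using \<open>p dvd n\<close> p(1) prime_dvd_power by blast
    qed
    then show False using assms(2) p(1) by (meson coprime_common_divisor not_prime_unit)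
  qed
  then obtain p z where pz: "p \<ge> 0" "z \<ge> 0" "m * n = p^2" "C = z^2"
    using coprime_mult_eq_power_int[OF _ \<open>C \<ge> 0\<close> _ C] assms(3,4) by auto
  then obtain x y where xy: "x \<ge> 0" "y \<ge> 0" "m = x^2" "n = y^2"
    using coprime_mult_eq_power_int[of m n p 2] assms by auto
  have "x^4 + x^2 * y^2 = z^2 + y^4"
    using pz(4) unfolding C_def xy(3,4) by simp
  moreover have "coprime x y" "x > 0" "y > 0" using assms xy by (auto simp: less_le)
  ultimately have "x = 1 \<and> y = 1" using quartic_solution pz(2) by blast
  then show ?thesis using xy by simp
qed

section \<open>Rational points on the minimal model\<close>

lemma rat_square_int:
  fixes q :: rat
  assumes "q^2 = of_int t"
  obtains k where "t = k^2"
proof -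
  obtain m n where mn: "quotient_of q = (m, n)" by fastforce
  then have cop: "coprime m n" and "n > 0" and q: "q = of_int m / of_int n"
    using quotient_of_coprime quotient_of_denom_pos quotient_of_div by blast+
  have "(of_int (m^2) :: rat) = of_int (t * n^2)"
    using assms \<open>n > 0\<close> by (simp add: q field_simps)
  then have m: "m^2 = t * n^2" by (simp only: of_int_eq_iff)
  then have "n^2 dvd m^2" by simp
  then have "is_unit n" using cop by (metis coprime_common_divisor dvd_refl pow_divides_pow_iff zero_less_numeral)
  then have "n = 1" using \<open>n > 0\<close> by simp
  then show thesis using that[of m] m by simp
qed

text \<open>For \<open>u = m / n\<close>, multiplying by \<open>n^4\<close> turns the equation into
  the one of \<open>square_product_solution\<close>, with square root
  \<open>y * n^2\<close>.\<close>

lemma cubic_square_solutions: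
  fixes u y :: rat
  assumes "y^2 = u^3 + u^2 - u"
  shows "u \<in> {0, 1, -1}"
proof -
  obtain m n where mn: "quotient_of u = (m, n)" by fastforce
  then have cop: "coprime m n" and n: "n > 0" and u: "u = of_int m / of_int n"
    using quotient_of_coprime quotient_of_denom_pos quotient_of_div by blast+
  have "(y * of_int n^2)^2 = of_int n^4 * (u^3 + u^2 - u)"
    unfolding assms[symmetric] by (simp add: power_mult_distrib)
  also have "\<dots> = of_int (m * n * (m^2 + m * n - n^2))"
    using n by (simp add: u field_simps eval_nat_numeral)
  finally obtain k where k: "m * n * (m^2 + m * n - n^2) = k^2" by (rule rat_square_int)
  consider "m = 0" | "m > 0" | "- m > 0" by linarith
  then show ?thesis
  proof cases
    case 1
    then show ?thesis by (simp add: u)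
  next
    case 2
    then show ?thesis using square_product_solution[OF k[symmetric] cop] n by (simp add: u)
  next
    case 3
    \<comment> \<open>Negative \<open>u\<close> is replaced by \<open>- 1 / u\<close>, the effect of
      translating by the 2-torsion point \<open>(0, 0)\<close>: the pair \<open>(m, n)\<close>
      becomes \<open>(n, - m)\<close>.\<close>
    have "k^2 = n * (- m) * (n^2 + n * (- m) - (- m)^2)"
      unfolding k[symmetric] by (simp add: algebra_simps)
    then have "n = 1 \<and> - m = 1" using square_product_solution[of k n "- m"] cop n 3
      by (simp add: coprime_commute)
    then show ?thesis by (auto simp: u)
  qed
qed

section \<open>Scaling isomorphisms and the exceptional curve\<close>

fun ec_scale :: "'a::field \<Rightarrow> 'a ec_point \<Rightarrow> 'a ec_point" where
  "ec_scale l Infinity = Infinity"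
| "ec_scale l (Affine x y) = Affine (l^2 * x) (l^3 * y)"

text \<open>Scaling maps the curve with coefficients \<open>A\<close>, \<open>B\<close> to the one
  with \<open>l^4 * A\<close>, \<open>l^6 * B\<close> and multiplies the slopes of chords and
  tangents by \<open>l\<close>.\<close>

lemma ec_scale_add:
  fixes A l :: "'a::field_char_0"
  assumes "l \<noteq> 0"
  shows "ec_scale l (ec_add A P Q) = ec_add (l^4 * A) (ec_scale l P) (ec_scale l Q)"
proof (cases "P = Infinity \<or> Q = Infinity")
  case False
  then obtain x1 y1 x2 y2 where PQ: "P = Affine x1 y1" "Q = Affine x2 y2"
    by (metis ec_point.exhaust)
  have eq: "l^3 * y1 = - (l^3 * y2) \<longleftrightarrow> y1 = - y2"
    using assms by (simp flip: mult_minus_right)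
  consider "x1 = x2" "y1 = - y2" | m where "x1 = x2" "y1 \<noteq> - y2"
      "(3 * x1^2 + A) / (2 * y1) = m" "(3 * (l^2 * x1)^2 + l^4 * A) / (2 * (l^3 * y1)) = l * m"
    | m where "x1 \<noteq> x2" "(y2 - y1) / (x2 - x1) = m"
      "(l^3 * y2 - l^3 * y1) / (l^2 * x2 - l^2 * x1) = l * m"
  proof -
    have "(3 * (l^2 * x1)^2 + l^4 * A) / (2 * (l^3 * y1)) = l * ((3 * x1^2 + A) / (2 * y1))"
    proof -
      have "3 * (l^2 * x1)^2 + l^4 * A = l^3 * (l * (3 * x1^2 + A))" by algebra
      then show ?thesis using assms by (simp add: mult.left_commute)
    qed
    moreover have "(l^3 * y2 - l^3 * y1) / (l^2 * x2 - l^2 * x1) = l * ((y2 - y1) / (x2 - x1))"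
    proof -
      have "l^3 * y2 - l^3 * y1 = l^2 * (l * (y2 - y1))" "l^2 * x2 - l^2 * x1 = l^2 * (x2 - x1)"
        by algebra+
      then show ?thesis using assms by simp
    qed
    ultimately show ?thesis using that by blast
  qed
  then show ?thesis
  proof cases
    case 1
    then show ?thesis by (simp add: PQ)
  next
    case (2 m)
    then show ?thesis using assms
      by (simp only: PQ ec_add.simps ec_scale.simps eq Let_def) (simp add: algebra_simps eval_nat_numeral)
  next
    case (3 m)
    then show ?thesis using assms
      by (simp only: PQ ec_add.simps ec_scale.simps Let_def) (simp add: algebra_simps eval_nat_numeral)
  qed
qed auto

lemma ec_scale_pow:
  fixes A l :: "'a::field_char_0"
  assumes "l \<noteq> 0"
  shows "ec_scale l P [^]\<^bsub>ec_group (l^4 * A) B'\<^esub> (n::nat) = ec_scale l (P [^]\<^bsub>ec_group A B\<^esub> n)"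
  by (induction n) (simp_all add: ec_scale_add[OF assms])

lemma ec_scale_surj:
  fixes A l :: "'a::field_char_0"
  assumes "l \<noteq> 0" "P \<in> ec_points (l^4 * A) (l^6 * B)"
  obtains Q where "Q \<in> ec_points A B" "P = ec_scale l Q"
proof (cases P)
  case Infinity
  then show thesis using that[of Infinity] by (simp add: ec_points_def)
next
  case (Affine x y)
  define x' y' where "x' = x / l^2" and "y' = y / l^3"
  have xy: "x = l^2 * x'" "y = l^3 * y'" using assms(1) by (simp_all add: x'_def y'_def)
  have "y^2 = x^3 + l^4 * A * x + l^6 * B" using assms(2) Affine by (simp add: ec_points_def)
  then have "l^6 * y'^2 = l^6 * (x'^3 + A * x' + B)" unfolding xy by algebra
  then have "y'^2 = x'^3 + A * x' + B" using assms(1) by simp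
  then show thesis using that[of "Affine x' y'"] Affine xy by (simp add: ec_points_def)
qed

lemma ec_points_conductor_20:
  "ec_points (-108) (297 :: rat) \<subseteq>
    {Infinity, Affine 3 0, Affine 12 27, Affine 12 (-27), Affine (-6) 27, Affine (-6) (-27)}"
proof
  fix P :: "rat ec_point" assume P: "P \<in> ec_points (-108) 297"
  show "P \<in> {Infinity, Affine 3 0, Affine 12 27, Affine 12 (-27), Affine (-6) 27, Affine (-6) (-27)}"
  proof (cases P)
    case (Affine x y)
    then have y: "y^2 = x^3 - 108 * x + 297" using P by (simp add: ec_points_def)
    \<comment> \<open>The minimal model is \<open>y^2 = u^3 + u^2 - u\<close> with \<open>u = (x - 3) / 9\<close>.\<close>
    have "(y / 27)^2 = ((x - 3) / 9)^3 + ((x - 3) / 9)^2 - (x - 3) / 9"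
      unfolding power_divide y by (simp add: field_simps eval_nat_numeral)
    then have "(x - 3) / 9 \<in> {0, 1, -1}" by (rule cubic_square_solutions)
    then have x: "x \<in> {3, 12, -6}" by auto
    then have "y^2 = 0 \<and> x = 3 \<or> y^2 = 27^2 \<and> x \<in> {12, -6}" using y by auto
    then show ?thesis unfolding Affine power2_eq_iff by auto
  qed simp
qed

lemma ec_pow_6_conductor_20:
  assumes "P \<in> ec_points (-108) (297 :: rat)"
  shows "P [^]\<^bsub>ec_group (-108) 297\<^esub> (6::nat) = Infinity"
proof -
  have "P [^]\<^bsub>ec_group (-108) 297\<^esub> (6::nat) = ec_add (-108) (ec_add (-108) (ec_add (-108)
      (ec_add (-108) (ec_add (-108) P P) P) P) P) P"
    by (simp add: numeral_eq_Suc del: ec_add.simps(3))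
  \<comment> \<open>The affine points have order 2 for \<open>x = 3\<close>, order 3 for
    \<open>x = 12\<close> and order 6 for \<open>x = - 6\<close>.\<close>
  then show ?thesis using subsetD[OF ec_points_conductor_20 assms]
    by (auto simp: Let_def)
qed

lemma E4_rank_eq_0:
  fixes a b c :: rat
  assumes "a * b * c \<noteq> 0" "b^2 = 3 / 2 * a * c"
  shows "abelian_rank (E4_group a b c) = 0"
proof -
  \<comment> \<open>With \<open>a * c = 2 / 3 * b^2\<close> the coefficients are
    \<open>- 4 / 3 * (a * b)^4\<close> and \<open>11 / 27 * (a * b)^6\<close>; the divisor 3 makes
    them integral multiples of \<open>l^4\<close> and \<open>l^6\<close>.\<close>
  define l where "l = a * b / 3"
  have l: "l \<noteq> 0" using assms by (auto simp: l_def)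
  have ac: "a * c = 2 / 3 * b^2" using assms(2) by simp
  have "E4_A a b c = - 3 * a^4 * (a * c)^2" unfolding E4_A_def by algebra
  also have "\<dots> = l^4 * (-108)" unfolding ac l_def by (simp add: power_mult_distrib power_divide)
  finally have A: "E4_A a b c = l^4 * (-108)" .
  have "E4_B a b c = - (a^6 * (2 * (a * c) - b^2) * ((a * c)^2 - 4 * (a * c) * b^2 + b^4))"
    unfolding E4_B_def by algebra
  also have "\<dots> = l^6 * 297"
    unfolding ac l_def by (simp add: field_simps eval_nat_numeral)
  finally have B: "E4_B a b c = l^6 * 297" .
  show ?thesis
    unfolding E4_group_def A B
  proof (rule abelian_rank_ec_eq_0)
    fix P assume "P \<in> ec_points (l^4 * (-108)) (l^6 * 297)"
    then obtain Q where Q: "Q \<in> ec_points (-108) 297" "P = ec_scale l Q"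
      by (rule ec_scale_surj[OF l])
    show "P [^]\<^bsub>ec_group (l^4 * (-108)) (l^6 * 297)\<^esub> (6::nat) = Infinity"
      unfolding Q(2) ec_scale_pow[OF l, where B = 297] ec_pow_6_conductor_20[OF Q(1)] by simp
  qed simp
qed

theorem theorem2p8:
  fixes a b c :: rat
  assumes "a * b * c \<noteq> 0"
    and "a * c - b^2 \<noteq> 0"
    and "3 * a * c - b^2 \<noteq> 0"
    and "4 * a * c - b^2 \<noteq> 0"
  shows "(b^2 \<noteq> 3 / 2 * a * c \<longrightarrow> abelian_rank (E4_group a b c) > 0) \<and>
         (b^2 = 3 / 2 * a * c \<longrightarrow> abelian_rank (E4_group a b c) = 0)"
  using E4_rank_pos[OF assms] E4_rank_eq_0[OF assms(1)] by blast

end
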